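(* Let $(A,\cdot_A,[-,-]_A,P)$ be a relative Poisson algebra. Suppose that there is a relative Poisson algebra structure $(A^*,\cdot_{A^*},[-,-]_{A^*},Q^* )$ on the dual space $A^*$ which is given by a relative Poisson coalgebra $(A,\Delta,\delta,Q)$, that is, $a^*\cdot_{A^*}b^*=\Delta^*(a^*\otimes b^* )$, $[a^*,b^*]_{A^*}=\delta^*(a^*\otimes b^* )$ for all $a^*,b^*\in A^*$, and $Q^*$ is the dual map of $Q:A\to A$. Then the following conditions are equivalent: (1) There is a Manin triple of relative Poisson algebras $((A\bowtie A^*,P+Q^*,\mathcal B_d),(A,P),(A^*,Q^* ))$. (2) $((A,P),(A^*,Q^* ),-\mathcal L_A^*,\mathrm{ad}_A^*,-\mathcal L_{A^*}^*,\mathrm{ad}_{A^*}^* )$ is a matched pair of relative Poisson algebras. (3) $(A,\cdot_A,[-,-]_A,\Delta,\delta,P,Q)$ is a relative Poisson bialgebra.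
   Context: All vector spaces are finite-dimensional over an algebraically closed field $\mathbb K$ of characteristic zero. Relative Poisson algebra. $(A,\cdot,[-,-],P)$, abbreviated $(A,P)$: $(A,\cdot)$ is a commutative associative (not necessarily unital) algebra, $(A,[-,-])$ is a Lie algebra, $P:A\to A$ is a linear map that is a derivation of both $\cdot$ and $[-,-]$, and $[z,x\cdot y]=[z,x]\cdot y+x\cdot[z,y]+x\cdot y\cdot P(z)$ for all $x,y,z\in A$. A relative Poisson subalgebra is a subspace closed under all operations, with the restricted operations. Notation. $\mathcal L_A(x)y=x\cdot_A y$, $\mathrm{ad}_A(x)y=[x,y]_A$, and similarly for $A^*$. For a linear map $\varphi:A\to\mathrm{End}(V)$, $\varphi^*:A\to\mathrm{End}(V^* )$ is defined by $\langle\varphi^*(x)u^*,v\rangle=-\langle u^*,\varphi(x)v\rangle$ (with a sign). For a linear map $T:V_1\to V_2$ between vector spaces, $T^*:V_2^*\to V_1^*$ is the usual dual map (no sign). $\mathcal L_{A^*}^*,\mathrm{ad}_{A^*}^*:A^*\to\mathrm{End}(A)$ via $A^{**}=A$. For linear maps $\phi_i:V_i\to V_i$, $\phi_1+\phi_2$ denotes the map $v_1+v_2\mapsto\phi_1(v_1)+\phi_2(v_2)$ on $V_1\oplus V_2$. $\tau(x\otimes y)=y\otimes x$. Representation of $(A,P)$. A quadruple $(\mu,\rho,\alpha,V)$ with $\mu,\rho:A\to\mathrm{End}(V)$, $\alpha:V\to V$ linear such that for all $x,y\in A$, $v\in V$: $\mu(x\cdot y)=\mu(x)\mu(y)$; $\rho([x,y])=\rho(x)\rho(y)-\rho(y)\rho(x)$;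 $\rho(y)\mu(x)v-\mu(x)\rho(y)v+\mu([x,y])v-\mu(x\cdot P(y))v=0$; $\alpha(\mu(x)v)-\mu(P(x))v-\mu(x)\alpha(v)=0$; $\alpha(\rho(x)v)-\rho(P(x))v-\rho(x)\alpha(v)=0$; $\rho(x\cdot y)v-\mu(x)\rho(y)v-\mu(y)\rho(x)v+\mu(x\cdot y)\alpha(v)=0$. A linear map $Q:A\to A$ dually represents $(A,P)$ if $(-\mathcal L^*,\mathrm{ad}^*,Q^*,A^* )$ is a representation of $(A,P)$. Matched pair of relative Poisson algebras. $((A_1,P_1),(A_2,P_2),\mu_1,\rho_1,\mu_2,\rho_2)$, where $(A_i,\cdot_i,[-,-]_i,P_i)$ are relative Poisson algebras, $(\mu_1,\rho_1,P_2,A_2)$ is a representation of $(A_1,P_1)$, $(\mu_2,\rho_2,P_1,A_1)$ is a representation of $(A_2,P_2)$, and for all $x,y\in A_1$, $a,b\in A_2$: (i) $\mu_1(x)(a\cdot_2b)=(\mu_1(x)a)\cdot_2b+\mu_1(\mu_2(a)x)b$ and $\mu_2(a)(x\cdot_1y)=(\mu_2(a)x)\cdot_1y+\mu_2(\mu_1(x)a)y$; (ii) $\rho_1(x)[a,b]_2-[\rho_1(x)a,b]_2-[a,\rho_1(x)b]_2+\rho_1(\rho_2(a)x)b-\rho_1(\rho_2(b)x)a=0$ and $\rho_2(a)[x,y]_1-[\rho_2(a)x,y]_1-[x,\rho_2(a)y]_1+\rho_2(\rho_1(x)a)y-\rho_2(\rho_1(y)a)x=0$; (iii) $\rho_2(a)(x\cdot_1y)+\mu_2(\rho_1(y)a)x-x\cdot_1\rho_2(a)y+\mu_2(\rho_1(x)a)y-y\cdot_1\rho_2(a)x-\mu_2(P_2(a))(x\cdot_1y)=0$;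 (iv) $\rho_1(x)(a\cdot_2b)+\mu_1(\rho_2(b)x)a-a\cdot_2\rho_1(x)b+\mu_1(\rho_2(a)x)b-b\cdot_2\rho_1(x)a-\mu_1(P_1(x))(a\cdot_2b)=0$; (v) $\rho_2(\mu_1(x)a)y+[\mu_2(a)x,y]_1-x\cdot_1\rho_2(a)y+\mu_2(\rho_1(y)a)x-\mu_2(a)([x,y]_1)+\mu_2(a)(x\cdot_1P_1(y))=0$; (vi) $\rho_1(\mu_2(a)x)b+[\mu_1(x)a,b]_2-a\cdot_2\rho_1(x)b+\mu_1(\rho_2(b)x)a-\mu_1(x)([a,b]_2)+\mu_1(x)(a\cdot_2P_2(b))=0$. Manin triple. $((A\bowtie A^*,P+Q^*,\mathcal B_d),(A,P),(A^*,Q^* ))$: a relative Poisson algebra structure on $A\oplus A^*$ with derivation $P+Q^*$, containing $(A,P)$ and $(A^*,Q^* )$ as relative Poisson subalgebras, such that the bilinear form $\mathcal B_d(x+a^*,y+b^* )=\langle x,b^*\rangle+\langle a^*,y\rangle$ is invariant, i.e. $\mathcal B_d(u\cdot v,w)=\mathcal B_d(u,v\cdot w)$ and $\mathcal B_d([u,v],w)=\mathcal B_d(u,[v,w])$. Relative Poisson coalgebra $(A,\Delta,\delta,Q)$. Linear maps $\Delta,\delta:A\to A\otimes A$, $Q:A\to A$ with $\tau\Delta=\Delta$, $(\mathrm{id}\otimes\Delta)\Delta=(\Delta\otimes\mathrm{id})\Delta$; $\tau\delta=-\delta$, $(\mathrm{id}+\xi+\xi^2)(\mathrm{id}\otimes\delta)\delta=0$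 where $\xi(x\otimes y\otimes z)=y\otimes z\otimes x$; $\Delta Q=(Q\otimes\mathrm{id}+\mathrm{id}\otimes Q)\Delta$; $\delta Q=(Q\otimes\mathrm{id}+\mathrm{id}\otimes Q)\delta$; and $(\mathrm{id}\otimes\Delta)\delta(x)-(\delta\otimes\mathrm{id})\Delta(x)-(\tau\otimes\mathrm{id})(\mathrm{id}\otimes\delta)\Delta(x)-(Q\otimes\mathrm{id}\otimes\mathrm{id})(\Delta\otimes\mathrm{id})\Delta(x)=0$ for all $x\in A$. Relative Poisson bialgebra $(A,\cdot,[-,-],\Delta,\delta,P,Q)$. $(A,\cdot,[-,-],P)$ is a relative Poisson algebra; $(A,\Delta,\delta,Q)$ is a relative Poisson coalgebra; $Q$ dually represents $(A,P)$; $P^*$ dually represents $(A^*,Q^* )$, that is, $\Delta P=(P\otimes\mathrm{id}-\mathrm{id}\otimes Q)\Delta$, $\delta P=(P\otimes\mathrm{id}-\mathrm{id}\otimes Q)\delta$, $(\Delta\otimes\mathrm{id})\Delta(P+Q)=0$; and for all $x,y\in A$: $\Delta(x\cdot y)=(\mathcal L(x)\otimes\mathrm{id})\Delta(y)+(\mathrm{id}\otimes\mathcal L(y))\Delta(x)$; $\delta([x,y])=(\mathrm{ad}(x)\otimes\mathrm{id}+\mathrm{id}\otimes\mathrm{ad}(x))\delta(y)-(\mathrm{ad}(y)\otimes\mathrm{id}+\mathrm{id}\otimes\mathrm{ad}(y))\delta(x)$; $\delta(x\cdot y)-(\mathrm{id}\otimes\mathrm{ad}(y))\Delta(x)-(\mathcal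 L(x)\otimes\mathrm{id})\delta(y)-(\mathrm{id}\otimes\mathrm{ad}(x))\Delta(y)-(\mathcal L(y)\otimes\mathrm{id})\delta(x)-(\mathrm{id}\otimes Q)\Delta(x\cdot y)=0$; $\Delta([x,y])-(\mathcal L(y)\otimes\mathrm{id})\delta(x)-(\mathrm{id}\otimes\mathrm{ad}(x))\Delta(y)+(\mathrm{id}\otimes\mathcal L(y))\delta(x)-(\mathrm{ad}(x)\otimes\mathrm{id})\Delta(y)+\Delta(P(x)\cdot y)=0$. *)

theory Defs
  imports
    "HOL-Analysis.Product_Vector"
    "HOL-Library.Function_Algebras"
    "HOL-Computational_Algebra.Polynomial"
begin

text \<open>
  A vector space is given by its scalar multiplication \<open>s\<close> on a type and a carrier that is a
  subspace for \<open>s\<close>.  The algebra \<open>A\<close> itself is always a whole type; its dual is a subspace of the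
  type of all functions from \<open>A\<close> to the field, with pointwise operations.
  All operations matter only on the carriers.
\<close>

section \<open>Linear algebra on carriers\<close>

definition linear_on ::
  "('k::field \<Rightarrow> 'v::ab_group_add \<Rightarrow> 'v) \<Rightarrow> 'v set \<Rightarrow>
   ('k \<Rightarrow> 'w::ab_group_add \<Rightarrow> 'w) \<Rightarrow> 'w set \<Rightarrow> ('v \<Rightarrow> 'w) \<Rightarrow> bool" where
  "linear_on s V t W f \<longleftrightarrow>
     (\<forall>x\<in>V. f x \<in> W) \<and>
     (\<forall>x\<in>V. \<forall>y\<in>V. f (x + y) = f x + f y) \<and>
     (\<forall>c. \<forall>x\<in>V. f (s c x) = t c (f x))"

definition bilinear_on ::
  "('k::field \<Rightarrow> 'u::ab_group_add \<Rightarrow> 'u) \<Rightarrow> 'u set \<Rightarrow>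
   ('k \<Rightarrow> 'v::ab_group_add \<Rightarrow> 'v) \<Rightarrow> 'v set \<Rightarrow>
   ('k \<Rightarrow> 'w::ab_group_add \<Rightarrow> 'w) \<Rightarrow> 'w set \<Rightarrow> ('u \<Rightarrow> 'v \<Rightarrow> 'w) \<Rightarrow> bool" where
  "bilinear_on r U s V t W \<beta> \<longleftrightarrow>
     (\<forall>x\<in>U. linear_on s V t W (\<beta> x)) \<and>
     (\<forall>y\<in>V. linear_on r U t W (\<lambda>x. \<beta> x y))"

section \<open>Dual spaces\<close>

definition dual :: "('k::field \<Rightarrow> 'a::ab_group_add \<Rightarrow> 'a) \<Rightarrow> ('a \<Rightarrow> 'k) set" where
  "dual s = {f. Vector_Spaces.linear s (*) f}"

definition dscale :: "'k::field \<Rightarrow> ('a \<Rightarrow> 'k) \<Rightarrow> 'a \<Rightarrow> 'k" where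
  "dscale c f = (\<lambda>x. c * f x)"

definition dual_map :: "('v \<Rightarrow> 'w) \<Rightarrow> ('w \<Rightarrow> 'k) \<Rightarrow> 'v \<Rightarrow> 'k" where
  "dual_map T f = (\<lambda>x. f (T x))"

text \<open>The signed dual \<open>\<phi>\<^sup>*\<close> of a linear map \<open>\<phi>\<close> into the endomorphisms of \<open>A\<close>.\<close>

definition dual_act :: "('x \<Rightarrow> 'a \<Rightarrow> 'a) \<Rightarrow> 'x \<Rightarrow> ('a \<Rightarrow> 'k::field) \<Rightarrow> 'a \<Rightarrow> 'k" where
  "dual_act \<phi> x f = (\<lambda>v. - f (\<phi> x v))"

text \<open>
  The signed dual of a linear map \<open>\<phi>\<close> into the endomorphisms of the dual of \<open>A\<close>, with the bidual
  of \<open>A\<close> identified with \<open>A\<close>.  The vector described exists and is unique because \<open>A\<close> is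
  finite-dimensional.
\<close>

definition predual_act ::
  "('k::field \<Rightarrow> 'a::ab_group_add \<Rightarrow> 'a) \<Rightarrow> ('x \<Rightarrow> ('a \<Rightarrow> 'k) \<Rightarrow> 'a \<Rightarrow> 'k) \<Rightarrow> 'x \<Rightarrow> 'a \<Rightarrow> 'a" where
  "predual_act s \<phi> x v = (THE w. \<forall>f\<in>dual s. f w = - \<phi> x f v)"

section \<open>Tensors\<close>

text \<open>
  The elementary tensor of \<open>x\<close> and \<open>y\<close> is realised as the bilinear form sending \<open>(f, g)\<close> to
  \<open>f x * g y\<close> on the dual of \<open>A\<close> (and extended by 0 to pairs that are not both linear, so that equal
  tensors are equal functions); the second tensor power of \<open>A\<close> is the linear span of these, and
  likewise for three factors.  The induced maps between tensor powers are given by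
  formulas on such forms; the lemmas below record their values on elementary tensors.
\<close>

definition on_dual2 ::
  "('k::field \<Rightarrow> 'a::ab_group_add \<Rightarrow> 'a) \<Rightarrow> (('a \<Rightarrow> 'k) \<Rightarrow> ('a \<Rightarrow> 'k) \<Rightarrow> 'k)
    \<Rightarrow> ('a \<Rightarrow> 'k) \<Rightarrow> ('a \<Rightarrow> 'k) \<Rightarrow> 'k" where
  "on_dual2 s t = (\<lambda>f g. if f \<in> dual s \<and> g \<in> dual s then t f g else 0)"

definition on_dual3 ::
  "('k::field \<Rightarrow> 'a::ab_group_add \<Rightarrow> 'a) \<Rightarrow> (('a \<Rightarrow> 'k) \<Rightarrow> ('a \<Rightarrow> 'k) \<Rightarrow> ('a \<Rightarrow> 'k) \<Rightarrow> 'k)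
    \<Rightarrow> ('a \<Rightarrow> 'k) \<Rightarrow> ('a \<Rightarrow> 'k) \<Rightarrow> ('a \<Rightarrow> 'k) \<Rightarrow> 'k" where
  "on_dual3 s t = (\<lambda>f g h. if f \<in> dual s \<and> g \<in> dual s \<and> h \<in> dual s then t f g h else 0)"

definition tensor2 where
  "tensor2 s x y = on_dual2 s (\<lambda>f g. f x * g y)"

definition tensor3 where
  "tensor3 s x y z = on_dual3 s (\<lambda>f g h. f x * g y * h z)"

definition tscale2 :: "'k::field \<Rightarrow> ('d \<Rightarrow> 'd \<Rightarrow> 'k) \<Rightarrow> 'd \<Rightarrow> 'd \<Rightarrow> 'k" where
  "tscale2 c t = (\<lambda>f g. c * t f g)"

definition tensor_square ::
  "('k::field \<Rightarrow> 'a::ab_group_add \<Rightarrow> 'a) \<Rightarrow> (('a \<Rightarrow> 'k) \<Rightarrow> ('a \<Rightarrow> 'k) \<Rightarrow> 'k) set" where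
  "tensor_square s = module.span tscale2 {tensor2 s x y | x y. True}"

text \<open>The linear form on the tensor square given by two linear forms on \<open>A\<close>.\<close>

definition dual_tensor :: "'d \<Rightarrow> 'd \<Rightarrow> ('d \<Rightarrow> 'd \<Rightarrow> 'k) \<Rightarrow> 'k" where
  "dual_tensor f g t = t f g"

definition tmap where \<comment> \<open>\<open>F \<otimes> G\<close>\<close>
  "tmap s F G t = on_dual2 s (\<lambda>f g. t (dual_map F f) (dual_map G g))"

definition tmap3 where \<comment> \<open>\<open>F \<otimes> G \<otimes> H\<close>\<close>
  "tmap3 s F G H t = on_dual3 s (\<lambda>f g h. t (dual_map F f) (dual_map G g) (dual_map H h))"

definition id_tens where \<comment> \<open>\<open>id \<otimes> D\<close>, for \<open>D\<close> from \<open>A\<close> to its tensor square\<close>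
  "id_tens s D t = on_dual3 s (\<lambda>f g h. t f (dual_map D (dual_tensor g h)))"

definition tens_id where \<comment> \<open>\<open>D \<otimes> id\<close>, for \<open>D\<close> from \<open>A\<close> to its tensor square\<close>
  "tens_id s D t = on_dual3 s (\<lambda>f g h. t (dual_map D (dual_tensor f g)) h)"

definition flip2 :: "('d \<Rightarrow> 'd \<Rightarrow> 'k) \<Rightarrow> 'd \<Rightarrow> 'd \<Rightarrow> 'k" where \<comment> \<open>\<open>\<tau>\<close>\<close>
  "flip2 t = (\<lambda>f g. t g f)"

definition flip3 :: "('d \<Rightarrow> 'd \<Rightarrow> 'd \<Rightarrow> 'k) \<Rightarrow> 'd \<Rightarrow> 'd \<Rightarrow> 'd \<Rightarrow> 'k" where \<comment> \<open>\<open>\<tau> \<otimes> id\<close>\<close>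
  "flip3 t = (\<lambda>f g h. t g f h)"

definition rot3 :: "('d \<Rightarrow> 'd \<Rightarrow> 'd \<Rightarrow> 'k) \<Rightarrow> 'd \<Rightarrow> 'd \<Rightarrow> 'd \<Rightarrow> 'k" where \<comment> \<open>\<open>\<xi>\<close>\<close>
  "rot3 t = (\<lambda>f g h. t h f g)"

lemma vector_space_dscale: "vector_space dscale"
  by unfold_locales (auto simp: dscale_def algebra_simps fun_eq_iff)

lemma vector_space_tscale2: "vector_space tscale2"
  by unfold_locales (auto simp: tscale2_def algebra_simps fun_eq_iff)

lemma dual_map_in_dual:
  assumes "f \<in> dual t" "Vector_Spaces.linear s t T"
  shows "dual_map T f \<in> dual s"
  using Vector_Spaces.linear_compose[OF assms(2)] assms(1)
  by (simp add: dual_def dual_map_def comp_def)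

lemma dual_tensor_comp_in_dual:
  assumes "Vector_Spaces.linear s tscale2 D"
  shows "dual_map D (dual_tensor f g) \<in> dual s"
proof -
  interpret D: Vector_Spaces.linear s tscale2 D by fact
  show ?thesis
    unfolding dual_def dual_map_def dual_tensor_def mem_Collect_eq
    by unfold_locales (simp_all add: D.add D.scale tscale2_def algebra_simps)
qed

lemma dual_tensor_tensor2:
  "f \<in> dual s \<Longrightarrow> g \<in> dual s \<Longrightarrow> dual_tensor f g (tensor2 s x y) = f x * g y"
  by (simp add: dual_tensor_def tensor2_def on_dual2_def)

lemma tmap_tensor2:
  assumes "Vector_Spaces.linear s s F" "Vector_Spaces.linear s s G"
  shows "tmap s F G (tensor2 s x y) = tensor2 s (F x) (G y)"
  using dual_map_in_dual[OF _ assms(1)] dual_map_in_dual[OF _ assms(2)]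
  by (auto simp: tmap_def tensor2_def on_dual2_def fun_eq_iff) (simp_all add: dual_map_def)

lemma tmap3_tensor3:
  assumes "Vector_Spaces.linear s s F" "Vector_Spaces.linear s s G" "Vector_Spaces.linear s s H"
  shows "tmap3 s F G H (tensor3 s x y z) = tensor3 s (F x) (G y) (H z)"
  using dual_map_in_dual[OF _ assms(1)] dual_map_in_dual[OF _ assms(2)]
    dual_map_in_dual[OF _ assms(3)]
  by (auto simp: tmap3_def tensor3_def on_dual3_def fun_eq_iff) (simp_all add: dual_map_def)

lemma id_tens_tensor2:
  assumes "Vector_Spaces.linear s tscale2 D" and "D y = tensor2 s u v"
  shows "id_tens s D (tensor2 s x y) = tensor3 s x u v"
  using dual_tensor_comp_in_dual[OF assms(1)] assms(2)
  by (auto simp: id_tens_def tensor2_def tensor3_def on_dual2_def on_dual3_def fun_eq_iff)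
     (simp_all add: dual_map_def dual_tensor_def)

lemma tens_id_tensor2:
  assumes "Vector_Spaces.linear s tscale2 D" and "D x = tensor2 s u v"
  shows "tens_id s D (tensor2 s x y) = tensor3 s u v y"
  using dual_tensor_comp_in_dual[OF assms(1)] assms(2)
  by (auto simp: tens_id_def tensor2_def tensor3_def on_dual2_def on_dual3_def fun_eq_iff)
     (simp_all add: dual_map_def dual_tensor_def)

lemma flip2_tensor2: "flip2 (tensor2 s x y) = tensor2 s y x"
  by (auto simp: flip2_def tensor2_def on_dual2_def fun_eq_iff)

lemma flip3_tensor3: "flip3 (tensor3 s x y z) = tensor3 s y x z"
  by (auto simp: flip3_def tensor3_def on_dual3_def fun_eq_iff)

lemma rot3_tensor3: "rot3 (tensor3 s x y z) = tensor3 s y z x"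
  by (auto simp: rot3_def tensor3_def on_dual3_def fun_eq_iff)

section \<open>Relative Poisson algebras, representations, matched pairs\<close>

locale rel_poisson_algebra = vector_space s
  for s :: "'k::field \<Rightarrow> 'v::ab_group_add \<Rightarrow> 'v" +
  fixes V :: "'v set"
    and mul :: "'v \<Rightarrow> 'v \<Rightarrow> 'v"
    and br :: "'v \<Rightarrow> 'v \<Rightarrow> 'v"
    and P :: "'v \<Rightarrow> 'v"
  assumes subspace_carrier: "subspace V"
    and mul_bilinear: "bilinear_on s V s V s V mul"
    and mul_commute: "\<lbrakk>x \<in> V; y \<in> V\<rbrakk> \<Longrightarrow> mul x y = mul y x"
    and mul_assoc: "\<lbrakk>x \<in> V; y \<in> V; z \<in> V\<rbrakk> \<Longrightarrow> mul (mul x y) z = mul x (mul y z)"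
    and br_bilinear: "bilinear_on s V s V s V br"
    and br_self: "x \<in> V \<Longrightarrow> br x x = 0"
    and jacobi: "\<lbrakk>x \<in> V; y \<in> V; z \<in> V\<rbrakk> \<Longrightarrow>
        br x (br y z) + br y (br z x) + br z (br x y) = 0"
    and P_linear: "linear_on s V s V P"
    and P_mul: "\<lbrakk>x \<in> V; y \<in> V\<rbrakk> \<Longrightarrow> P (mul x y) = mul (P x) y + mul x (P y)"
    and P_br: "\<lbrakk>x \<in> V; y \<in> V\<rbrakk> \<Longrightarrow> P (br x y) = br (P x) y + br x (P y)"
    and rel_leibniz: "\<lbrakk>x \<in> V; y \<in> V; z \<in> V\<rbrakk> \<Longrightarrow>
        br z (mul x y) = mul (br z x) y + mul x (br z y) + mul (mul x y) (P z)"

locale rel_poisson_representation =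
  rel_poisson_algebra s V mul br P + W: vector_space t
  for s :: "'k::field \<Rightarrow> 'v::ab_group_add \<Rightarrow> 'v" and V mul br P
    and t :: "'k \<Rightarrow> 'w::ab_group_add \<Rightarrow> 'w" +
  fixes W :: "'w set"
    and \<mu> \<rho> :: "'v \<Rightarrow> 'w \<Rightarrow> 'w"
    and \<alpha> :: "'w \<Rightarrow> 'w"
  assumes subspace_module: "W.subspace W"
    and \<mu>_bilinear: "bilinear_on s V t W t W \<mu>"
    and \<rho>_bilinear: "bilinear_on s V t W t W \<rho>"
    and \<alpha>_linear: "linear_on t W t W \<alpha>"
    and \<mu>_mul: "\<lbrakk>x \<in> V; y \<in> V; v \<in> W\<rbrakk> \<Longrightarrow> \<mu> (mul x y) v = \<mu> x (\<mu> y v)"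
    and \<rho>_br: "\<lbrakk>x \<in> V; y \<in> V; v \<in> W\<rbrakk> \<Longrightarrow> \<rho> (br x y) v = \<rho> x (\<rho> y v) - \<rho> y (\<rho> x v)"
    and rep_\<rho>_\<mu>: "\<lbrakk>x \<in> V; y \<in> V; v \<in> W\<rbrakk> \<Longrightarrow>
        \<rho> y (\<mu> x v) - \<mu> x (\<rho> y v) + \<mu> (br x y) v - \<mu> (mul x (P y)) v = 0"
    and \<alpha>_\<mu>: "\<lbrakk>x \<in> V; v \<in> W\<rbrakk> \<Longrightarrow> \<alpha> (\<mu> x v) - \<mu> (P x) v - \<mu> x (\<alpha> v) = 0"
    and \<alpha>_\<rho>: "\<lbrakk>x \<in> V; v \<in> W\<rbrakk> \<Longrightarrow> \<alpha> (\<rho> x v) - \<rho> (P x) v - \<rho> x (\<alpha> v) = 0"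
    and \<rho>_mul: "\<lbrakk>x \<in> V; y \<in> V; v \<in> W\<rbrakk> \<Longrightarrow>
        \<rho> (mul x y) v - \<mu> x (\<rho> y v) - \<mu> y (\<rho> x v) + \<mu> (mul x y) (\<alpha> v) = 0"

definition dually_represents ::
  "('k::field \<Rightarrow> 'a::ab_group_add \<Rightarrow> 'a) \<Rightarrow> ('a \<Rightarrow> 'a \<Rightarrow> 'a) \<Rightarrow> ('a \<Rightarrow> 'a \<Rightarrow> 'a) \<Rightarrow>
   ('a \<Rightarrow> 'a) \<Rightarrow> ('a \<Rightarrow> 'a) \<Rightarrow> bool" where
  "dually_represents s mul br P Q \<longleftrightarrow>
     Vector_Spaces.linear s s Q \<and>
     rel_poisson_representation s UNIV mul br P
       dscale (dual s) (- dual_act mul) (dual_act br) (dual_map Q)"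

text \<open>
  In the two representations, the third structure map is the derivation of the other algebra.
\<close>

locale rel_poisson_matched_pair =
  A1: rel_poisson_representation s1 V1 mul1 br1 P1 s2 V2 \<mu>1 \<rho>1 P2 +
  A2: rel_poisson_representation s2 V2 mul2 br2 P2 s1 V1 \<mu>2 \<rho>2 P1
  for s1 :: "'k::field \<Rightarrow> 'v::ab_group_add \<Rightarrow> 'v" and V1 mul1 br1 P1
    and s2 :: "'k \<Rightarrow> 'w::ab_group_add \<Rightarrow> 'w" and V2 mul2 br2 P2
    and \<mu>1 \<rho>1 :: "'v \<Rightarrow> 'w \<Rightarrow> 'w"
    and \<mu>2 \<rho>2 :: "'w \<Rightarrow> 'v \<Rightarrow> 'v" +
  assumes mp_\<mu>1_mul: "\<lbrakk>x \<in> V1; a \<in> V2; b \<in> V2\<rbrakk> \<Longrightarrow>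
        \<mu>1 x (mul2 a b) = mul2 (\<mu>1 x a) b + \<mu>1 (\<mu>2 a x) b"
    and mp_\<mu>2_mul: "\<lbrakk>x \<in> V1; y \<in> V1; a \<in> V2\<rbrakk> \<Longrightarrow>
        \<mu>2 a (mul1 x y) = mul1 (\<mu>2 a x) y + \<mu>2 (\<mu>1 x a) y"
    and mp_\<rho>1_br: "\<lbrakk>x \<in> V1; a \<in> V2; b \<in> V2\<rbrakk> \<Longrightarrow>
        \<rho>1 x (br2 a b) - br2 (\<rho>1 x a) b - br2 a (\<rho>1 x b)
          + \<rho>1 (\<rho>2 a x) b - \<rho>1 (\<rho>2 b x) a = 0"
    and mp_\<rho>2_br: "\<lbrakk>x \<in> V1; y \<in> V1; a \<in> V2\<rbrakk> \<Longrightarrow>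
        \<rho>2 a (br1 x y) - br1 (\<rho>2 a x) y - br1 x (\<rho>2 a y)
          + \<rho>2 (\<rho>1 x a) y - \<rho>2 (\<rho>1 y a) x = 0"
    and mp_\<rho>2_mul: "\<lbrakk>x \<in> V1; y \<in> V1; a \<in> V2\<rbrakk> \<Longrightarrow>
        \<rho>2 a (mul1 x y) + \<mu>2 (\<rho>1 y a) x - mul1 x (\<rho>2 a y)
          + \<mu>2 (\<rho>1 x a) y - mul1 y (\<rho>2 a x) - \<mu>2 (P2 a) (mul1 x y) = 0"
    and mp_\<rho>1_mul: "\<lbrakk>x \<in> V1; a \<in> V2; b \<in> V2\<rbrakk> \<Longrightarrow>
        \<rho>1 x (mul2 a b) + \<mu>1 (\<rho>2 b x) a - mul2 a (\<rho>1 x b)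
          + \<mu>1 (\<rho>2 a x) b - mul2 b (\<rho>1 x a) - \<mu>1 (P1 x) (mul2 a b) = 0"
    and mp_\<mu>2_br: "\<lbrakk>x \<in> V1; y \<in> V1; a \<in> V2\<rbrakk> \<Longrightarrow>
        \<rho>2 (\<mu>1 x a) y + br1 (\<mu>2 a x) y - mul1 x (\<rho>2 a y)
          + \<mu>2 (\<rho>1 y a) x - \<mu>2 a (br1 x y) + \<mu>2 a (mul1 x (P1 y)) = 0"
    and mp_\<mu>1_br: "\<lbrakk>x \<in> V1; a \<in> V2; b \<in> V2\<rbrakk> \<Longrightarrow>
        \<rho>1 (\<mu>2 a x) b + br2 (\<mu>1 x a) b - mul2 a (\<rho>1 x b)
          + \<mu>1 (\<rho>2 b x) a - \<mu>1 x (br2 a b) + \<mu>1 x (mul2 a (P2 b)) = 0"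

section \<open>Manin triples\<close>

definition subalgebra_via ::
  "('v \<Rightarrow> 'w) \<Rightarrow> 'v set \<Rightarrow> ('v \<Rightarrow> 'v \<Rightarrow> 'v) \<Rightarrow> ('v \<Rightarrow> 'v \<Rightarrow> 'v) \<Rightarrow> ('v \<Rightarrow> 'v) \<Rightarrow>
   ('w \<Rightarrow> 'w \<Rightarrow> 'w) \<Rightarrow> ('w \<Rightarrow> 'w \<Rightarrow> 'w) \<Rightarrow> ('w \<Rightarrow> 'w) \<Rightarrow> bool" where
  "subalgebra_via i V mul br P mul' br' P' \<longleftrightarrow>
     (\<forall>x\<in>V. \<forall>y\<in>V. mul' (i x) (i y) = i (mul x y)) \<and>
     (\<forall>x\<in>V. \<forall>y\<in>V. br' (i x) (i y) = i (br x y)) \<and>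
     (\<forall>x\<in>V. P' (i x) = i (P x))"

definition B_d :: "'a \<times> ('a \<Rightarrow> 'k::field) \<Rightarrow> 'a \<times> ('a \<Rightarrow> 'k) \<Rightarrow> 'k" where
  "B_d u v = snd v (fst u) + snd u (fst v)"

text \<open>
  \<open>mul\<close>, \<open>br\<close>, \<open>P\<close> are the operations of \<open>A\<close>; \<open>mul'\<close>, \<open>br'\<close> and the dual of \<open>Q\<close> those of the dual
  of \<open>A\<close>; \<open>M\<close>, \<open>N\<close> are the product and the bracket on the direct sum.
\<close>

locale rel_poisson_manin_triple =
  rel_poisson_algebra "module_prod.scale s dscale" "UNIV \<times> dual s" M N "map_prod P (dual_map Q)" +
  A: rel_poisson_algebra s UNIV mul br P +
  D: rel_poisson_algebra dscale "dual s" mul' br' "dual_map Q"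
  for s :: "'k::field \<Rightarrow> 'a::ab_group_add \<Rightarrow> 'a" and mul br P mul' br' Q M N +
  assumes sub_A: "subalgebra_via (\<lambda>x. (x, 0)) UNIV mul br P M N (map_prod P (dual_map Q))"
    and sub_dual: "subalgebra_via (\<lambda>f. (0, f)) (dual s) mul' br' (dual_map Q)
          M N (map_prod P (dual_map Q))"
    and invariant_mul: "\<lbrakk>u \<in> UNIV \<times> dual s; v \<in> UNIV \<times> dual s; w \<in> UNIV \<times> dual s\<rbrakk> \<Longrightarrow>
          B_d (M u v) w = B_d u (M v w)"
    and invariant_br: "\<lbrakk>u \<in> UNIV \<times> dual s; v \<in> UNIV \<times> dual s; w \<in> UNIV \<times> dual s\<rbrakk> \<Longrightarrow>
          B_d (N u v) w = B_d u (N v w)"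

section \<open>Relative Poisson coalgebras and bialgebras\<close>

locale rel_poisson_coalgebra = vector_space s
  for s :: "'k::field \<Rightarrow> 'a::ab_group_add \<Rightarrow> 'a" +
  fixes \<Delta> \<delta> :: "'a \<Rightarrow> ('a \<Rightarrow> 'k) \<Rightarrow> ('a \<Rightarrow> 'k) \<Rightarrow> 'k"
    and Q :: "'a \<Rightarrow> 'a"
  assumes \<Delta>_linear: "Vector_Spaces.linear s tscale2 \<Delta>" and \<Delta>_range: "\<Delta> x \<in> tensor_square s"
    and \<delta>_linear: "Vector_Spaces.linear s tscale2 \<delta>" and \<delta>_range: "\<delta> x \<in> tensor_square s"
    and Q_linear: "Vector_Spaces.linear s s Q"
    and cocommutative: "flip2 (\<Delta> x) = \<Delta> x"
    and coassociative: "id_tens s \<Delta> (\<Delta> x) = tens_id s \<Delta> (\<Delta> x)"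
    and co_antisym: "flip2 (\<delta> x) = - \<delta> x"
    and co_jacobi: "id_tens s \<delta> (\<delta> x) + rot3 (id_tens s \<delta> (\<delta> x))
          + rot3 (rot3 (id_tens s \<delta> (\<delta> x))) = 0"
    and \<Delta>_Q: "\<Delta> (Q x) = tmap s Q id (\<Delta> x) + tmap s id Q (\<Delta> x)"
    and \<delta>_Q: "\<delta> (Q x) = tmap s Q id (\<delta> x) + tmap s id Q (\<delta> x)"
    and co_rel_leibniz: "id_tens s \<Delta> (\<delta> x) - tens_id s \<delta> (\<Delta> x) - flip3 (id_tens s \<delta> (\<Delta> x))
          - tmap3 s Q id id (tens_id s \<Delta> (\<Delta> x)) = 0"

text \<open>
  The assumptions \<open>\<Delta>_P\<close>, \<open>\<delta>_P\<close>, \<open>\<Delta>_\<Delta>_PQ\<close> spell out that the dual of \<open>P\<close> dually represents the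
  dual algebra with derivation the dual of \<open>Q\<close>.
\<close>

locale rel_poisson_bialgebra =
  rel_poisson_algebra s UNIV mul br P + coalg: rel_poisson_coalgebra s \<Delta> \<delta> Q
  for s :: "'k::field \<Rightarrow> 'a::ab_group_add \<Rightarrow> 'a" and mul br \<Delta> \<delta> P Q +
  assumes Q_dually_represents: "dually_represents s mul br P Q"
    and \<Delta>_P: "\<Delta> (P x) = tmap s P id (\<Delta> x) - tmap s id Q (\<Delta> x)"
    and \<delta>_P: "\<delta> (P x) = tmap s P id (\<delta> x) - tmap s id Q (\<delta> x)"
    and \<Delta>_\<Delta>_PQ: "tens_id s \<Delta> (\<Delta> (P x + Q x)) = 0"
    and \<Delta>_mul: "\<Delta> (mul x y) = tmap s (mul x) id (\<Delta> y) + tmap s id (mul y) (\<Delta> x)"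
    and \<delta>_br: "\<delta> (br x y) =
          (tmap s (br x) id (\<delta> y) + tmap s id (br x) (\<delta> y))
          - (tmap s (br y) id (\<delta> x) + tmap s id (br y) (\<delta> x))"
    and \<delta>_mul: "\<delta> (mul x y) - tmap s id (br y) (\<Delta> x) - tmap s (mul x) id (\<delta> y)
          - tmap s id (br x) (\<Delta> y) - tmap s (mul y) id (\<delta> x) - tmap s id Q (\<Delta> (mul x y)) = 0"
    and \<Delta>_br: "\<Delta> (br x y) - tmap s (mul y) id (\<delta> x) - tmap s id (br x) (\<Delta> y)
          + tmap s id (mul y) (\<delta> x) - tmap s (br x) id (\<Delta> y) + \<Delta> (mul (P x) y) = 0"

end

theory Submission
  imports Defs
begin

text \<open>
  Both equivalences come from expressing everything through the pairing between \<open>A\<close> and its dual.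

  Manin triples and matched pairs. Invariance of the pairing form leaves no freedom: for \<open>x\<close> in \<open>A\<close>
  and \<open>g\<close> in the dual, invariance moves the product of \<open>x\<close> and \<open>g\<close>, tested against an element of \<open>A\<close> or
  of the dual, to a product inside one of the two subalgebras. As the form is nondegenerate, the
  product and the bracket on the direct sum must be those built from the two algebras and their
  coadjoint actions (\<open>manin_triple_iff_double\<close>). For two arbitrary algebras acting on each other, the
  operations so built on the direct sum form a relative Poisson algebra exactly for a matched pair
  (\<open>matched_pair_iff_bowtie\<close>): the axioms of the direct sum, split by the number of arguments in either
  summand and by the component of the value, are the axioms of the two algebras, of the two
  representations and of the matched pair.

  Matched pairs and bialgebras. By means of the pairing, each compatibility condition of a matched pair becomes a
  scalar identity in two elements of \<open>A\<close> and two linear forms. There are four such identities: one for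
  associativity, one for the Jacobi identity, and two for the relative Leibniz rule, according to whether the
  bracketing argument lies in \<open>A\<close> or in the dual. Each occurs twice among the eight matched-pair axioms,
  once tested by a vector and once by a linear form; the four identities are the compatibility conditions of a
  bialgebra (the lemmas named \<open>mp_..._iff\<close>, and \<open>\<Delta>_mul_iff\<close>,
  \<open>\<delta>_br_iff\<close>, \<open>\<delta>_mul_iff\<close>, \<open>\<Delta>_br_iff\<close>). The representation
  of \<open>A\<close> is the same condition on both sides, and the representation of the dual algebra on
  \<open>A\<close> amounts to the three conditions relating \<open>P\<close> to the coalgebra
  (\<open>dual_representation_iff\<close>): its other axioms are transposes of the axioms of the dual algebra.
\<close>

section \<open>Bilinear maps on subspaces\<close>

text \<open>
  The carrier of the dual is a proper subspace of a function type, so additivity is available only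
  for arguments in the carriers; collecting it here gives conditional rewrite rules for
  each operation.
\<close>

locale bilinear_on_subspaces =
  R: vector_space r + S: vector_space s + T: vector_space t
  for r :: "'k::field \<Rightarrow> 'u::ab_group_add \<Rightarrow> 'u" and U :: "'u set"
    and s :: "'k \<Rightarrow> 'v::ab_group_add \<Rightarrow> 'v" and V :: "'v set"
    and t :: "'k \<Rightarrow> 'w::ab_group_add \<Rightarrow> 'w" and W :: "'w set"
    and \<beta> :: "'u \<Rightarrow> 'v \<Rightarrow> 'w" +
  assumes subspace_left: "R.subspace U" and subspace_right: "S.subspace V"
    and bilinear: "bilinear_on r U s V t W \<beta>"
begin

lemma closed: "\<lbrakk>x \<in> U; y \<in> V\<rbrakk> \<Longrightarrow> \<beta> x y \<in> W"
  using bilinear by (simp add: bilinear_on_def linear_on_def)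

lemma add_left: "\<lbrakk>x \<in> U; x' \<in> U; y \<in> V\<rbrakk> \<Longrightarrow> \<beta> (x + x') y = \<beta> x y + \<beta> x' y"
  and add_right: "\<lbrakk>x \<in> U; y \<in> V; y' \<in> V\<rbrakk> \<Longrightarrow> \<beta> x (y + y') = \<beta> x y + \<beta> x y'"
  and scale_left: "\<lbrakk>x \<in> U; y \<in> V\<rbrakk> \<Longrightarrow> \<beta> (r c x) y = t c (\<beta> x y)"
  and scale_right: "\<lbrakk>x \<in> U; y \<in> V\<rbrakk> \<Longrightarrow> \<beta> x (s c y) = t c (\<beta> x y)"
  using bilinear by (simp_all add: bilinear_on_def linear_on_def)

lemma diff_left: "\<lbrakk>x \<in> U; x' \<in> U; y \<in> V\<rbrakk> \<Longrightarrow> \<beta> (x - x') y = \<beta> x y - \<beta> x' y"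
  using add_left[of "x - x'" x' y] R.subspace_diff[OF subspace_left] by simp

lemma diff_right: "\<lbrakk>x \<in> U; y \<in> V; y' \<in> V\<rbrakk> \<Longrightarrow> \<beta> x (y - y') = \<beta> x y - \<beta> x y'"
  using add_right[of x "y - y'" y'] S.subspace_diff[OF subspace_right] by simp

lemma zero_left: "y \<in> V \<Longrightarrow> \<beta> 0 y = 0"
  using add_left[of 0 0 y] R.subspace_0[OF subspace_left] by simp

lemma zero_right: "x \<in> U \<Longrightarrow> \<beta> x 0 = 0"
  using add_right[of x 0 0] S.subspace_0[OF subspace_right] by simp

lemma minus_left: "\<lbrakk>x \<in> U; y \<in> V\<rbrakk> \<Longrightarrow> \<beta> (- x) y = - \<beta> x y"
  using diff_left[of 0 x y] R.subspace_0[OF subspace_left] by (simp add: zero_left)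

lemma minus_right: "\<lbrakk>x \<in> U; y \<in> V\<rbrakk> \<Longrightarrow> \<beta> x (- y) = - \<beta> x y"
  using diff_right[of x 0 y] S.subspace_0[OF subspace_right] by (simp add: zero_right)

lemmas distribs = add_left add_right diff_left diff_right minus_left minus_right
lemmas zeros = zero_left zero_right

end

context rel_poisson_algebra
begin

sublocale mul: bilinear_on_subspaces s V s V s V mul
  by unfold_locales (rule subspace_carrier mul_bilinear)+
sublocale br: bilinear_on_subspaces s V s V s V br
  by unfold_locales (rule subspace_carrier br_bilinear)+

lemmas subspace_closed = subspace_0[OF subspace_carrier] subspace_add[OF subspace_carrier]
  subspace_diff[OF subspace_carrier] subspace_neg[OF subspace_carrier]
  subspace_scale[OF subspace_carrier]

lemma P_closed: "x \<in> V \<Longrightarrow> P x \<in> V"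
  and P_add: "\<lbrakk>x \<in> V; y \<in> V\<rbrakk> \<Longrightarrow> P (x + y) = P x + P y"
  and P_scale: "x \<in> V \<Longrightarrow> P (s c x) = s c (P x)"
  using P_linear by (simp_all add: linear_on_def)

lemma P_diff: "\<lbrakk>x \<in> V; y \<in> V\<rbrakk> \<Longrightarrow> P (x - y) = P x - P y"
  using P_add[of "x - y" y] by (simp add: subspace_closed)

lemma P_zero: "P 0 = 0"
  using P_diff[of 0 0] by (simp add: subspace_closed)

lemma P_minus: "x \<in> V \<Longrightarrow> P (- x) = - P x"
  using P_diff[of 0 x] by (simp add: subspace_closed P_zero)

lemma br_anti:
  assumes "x \<in> V" "y \<in> V"
  shows "br x y = - br y x"
proof -
  have "br (x + y) (x + y) = br x y + br y x"
    using assms br_self[of x] br_self[of y] by (simp add: br.distribs subspace_closed)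
  then show ?thesis
    using assms by (simp add: br_self subspace_closed eq_neg_iff_add_eq_0)
qed

end

section \<open>The direct sum of two algebras acting on each other\<close>

definition bowtie_mul ::
  "('v \<Rightarrow> 'v \<Rightarrow> 'v) \<Rightarrow> ('w \<Rightarrow> 'w \<Rightarrow> 'w) \<Rightarrow> ('v \<Rightarrow> 'w \<Rightarrow> 'w) \<Rightarrow> ('w \<Rightarrow> 'v \<Rightarrow> 'v)
    \<Rightarrow> 'v::ab_group_add \<times> 'w::ab_group_add \<Rightarrow> 'v \<times> 'w \<Rightarrow> 'v \<times> 'w" where
  "bowtie_mul mul1 mul2 \<mu>1 \<mu>2 = (\<lambda>(x, a) (y, b).
     (mul1 x y + \<mu>2 a y + \<mu>2 b x, mul2 a b + \<mu>1 x b + \<mu>1 y a))"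

definition bowtie_br ::
  "('v \<Rightarrow> 'v \<Rightarrow> 'v) \<Rightarrow> ('w \<Rightarrow> 'w \<Rightarrow> 'w) \<Rightarrow> ('v \<Rightarrow> 'w \<Rightarrow> 'w) \<Rightarrow> ('w \<Rightarrow> 'v \<Rightarrow> 'v)
    \<Rightarrow> 'v::ab_group_add \<times> 'w::ab_group_add \<Rightarrow> 'v \<times> 'w \<Rightarrow> 'v \<times> 'w" where
  "bowtie_br br1 br2 \<rho>1 \<rho>2 = (\<lambda>(x, a) (y, b).
     (br1 x y + \<rho>2 a y - \<rho>2 b x, br2 a b + \<rho>1 x b - \<rho>1 y a))"

lemma bowtie_mul_apply [simp]:
  "bowtie_mul mul1 mul2 \<mu>1 \<mu>2 (x, a) (y, b) =
     (mul1 x y + \<mu>2 a y + \<mu>2 b x, mul2 a b + \<mu>1 x b + \<mu>1 y a)"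
  by (simp add: bowtie_mul_def)

lemma bowtie_br_apply [simp]:
  "bowtie_br br1 br2 \<rho>1 \<rho>2 (x, a) (y, b) =
     (br1 x y + \<rho>2 a y - \<rho>2 b x, br2 a b + \<rho>1 x b - \<rho>1 y a)"
  by (simp add: bowtie_br_def)

text \<open>
  The raw material for a matched pair: bilinear actions of two algebras on each other, before any
  compatibility. The setting is symmetric in the two algebras.
\<close>

locale rel_poisson_pair =
  A1: rel_poisson_algebra s1 V1 mul1 br1 P1 + A2: rel_poisson_algebra s2 V2 mul2 br2 P2
  for s1 :: "'k::field \<Rightarrow> 'v::ab_group_add \<Rightarrow> 'v" and V1 mul1 br1 P1
    and s2 :: "'k \<Rightarrow> 'w::ab_group_add \<Rightarrow> 'w" and V2 mul2 br2 P2 +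
  fixes \<mu>1 \<rho>1 :: "'v \<Rightarrow> 'w \<Rightarrow> 'w"
    and \<mu>2 \<rho>2 :: "'w \<Rightarrow> 'v \<Rightarrow> 'v"
  assumes \<mu>1_bilinear: "bilinear_on s1 V1 s2 V2 s2 V2 \<mu>1"
    and \<rho>1_bilinear: "bilinear_on s1 V1 s2 V2 s2 V2 \<rho>1"
    and \<mu>2_bilinear: "bilinear_on s2 V2 s1 V1 s1 V1 \<mu>2"
    and \<rho>2_bilinear: "bilinear_on s2 V2 s1 V1 s1 V1 \<rho>2"
begin

sublocale \<mu>1: bilinear_on_subspaces s1 V1 s2 V2 s2 V2 \<mu>1
  by unfold_locales (rule A1.subspace_carrier A2.subspace_carrier \<mu>1_bilinear)+
sublocale \<rho>1: bilinear_on_subspaces s1 V1 s2 V2 s2 V2 \<rho>1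
  by unfold_locales (rule A1.subspace_carrier A2.subspace_carrier \<rho>1_bilinear)+
sublocale \<mu>2: bilinear_on_subspaces s2 V2 s1 V1 s1 V1 \<mu>2
  by unfold_locales (rule A1.subspace_carrier A2.subspace_carrier \<mu>2_bilinear)+
sublocale \<rho>2: bilinear_on_subspaces s2 V2 s1 V1 s1 V1 \<rho>2
  by unfold_locales (rule A1.subspace_carrier A2.subspace_carrier \<rho>2_bilinear)+
sublocale prod: vector_space_prod s1 s2 ..

lemmas subspace_closed = A1.subspace_closed A2.subspace_closed

lemmas all_closed = subspace_closed A1.mul.closed A2.mul.closed A1.br.closed A2.br.closed
  \<mu>1.closed \<mu>2.closed \<rho>1.closed \<rho>2.closed A1.P_closed A2.P_closed
lemmas all_distribs = A1.mul.distribs A2.mul.distribs A1.br.distribs A2.br.distribs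
  \<mu>1.distribs \<mu>2.distribs \<rho>1.distribs \<rho>2.distribs A1.P_add A2.P_add A1.P_diff A2.P_diff
lemmas all_zeros = A1.mul.zeros A2.mul.zeros A1.br.zeros A2.br.zeros
  \<mu>1.zeros \<mu>2.zeros \<rho>1.zeros \<rho>2.zeros A1.P_zero A2.P_zero
lemmas all_scales = A1.mul.scale_left A1.mul.scale_right A2.mul.scale_left A2.mul.scale_right
  A1.br.scale_left A1.br.scale_right A2.br.scale_left A2.br.scale_right
  \<mu>1.scale_left \<mu>1.scale_right \<mu>2.scale_left \<mu>2.scale_right
  \<rho>1.scale_left \<rho>1.scale_right \<rho>2.scale_left \<rho>2.scale_right A1.P_scale A2.P_scale
  A1.scale_right_distrib A2.scale_right_distrib
  A1.scale_right_diff_distrib A2.scale_right_diff_distrib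

lemma bowtie_mul_bilinear:
  "bilinear_on prod.scale (V1 \<times> V2) prod.scale (V1 \<times> V2) prod.scale (V1 \<times> V2)
     (bowtie_mul mul1 mul2 \<mu>1 \<mu>2)"
  by (auto simp: bilinear_on_def linear_on_def prod.scale_prod all_closed all_distribs all_scales)

lemma bowtie_br_bilinear:
  "bilinear_on prod.scale (V1 \<times> V2) prod.scale (V1 \<times> V2) prod.scale (V1 \<times> V2)
     (bowtie_br br1 br2 \<rho>1 \<rho>2)"
  by (auto simp: bilinear_on_def linear_on_def prod.scale_prod all_closed all_distribs all_scales)

end

text \<open>
  By this symmetry only the second component of each axiom of the direct sum has to be verified; the
  first component is the second component of the direct sum taken in the opposite order.
\<close>

lemma rel_poisson_matched_pair_swap:
  assumes "rel_poisson_matched_pair s1 V1 mul1 br1 P1 s2 V2 mul2 br2 P2 \<mu>1 \<rho>1 \<mu>2 \<rho>2"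
  shows "rel_poisson_matched_pair s2 V2 mul2 br2 P2 s1 V1 mul1 br1 P1 \<mu>2 \<rho>2 \<mu>1 \<rho>1"
proof -
  interpret rel_poisson_matched_pair s1 V1 mul1 br1 P1 s2 V2 mul2 br2 P2 \<mu>1 \<rho>1 \<mu>2 \<rho>2 by fact
  show ?thesis
    by unfold_locales
      (rule mp_\<mu>1_mul mp_\<mu>2_mul mp_\<rho>1_br mp_\<rho>2_br mp_\<rho>1_mul mp_\<rho>2_mul mp_\<mu>1_br mp_\<mu>2_br; assumption)+
qed

sublocale rel_poisson_matched_pair \<subseteq> rel_poisson_pair s1 V1 mul1 br1 P1 s2 V2 mul2 br2 P2 \<mu>1 \<rho>1 \<mu>2 \<rho>2
  by unfold_locales (rule A1.\<mu>_bilinear A2.\<mu>_bilinear A1.\<rho>_bilinear A2.\<rho>_bilinear)+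

context rel_poisson_matched_pair
begin

abbreviation "dmul \<equiv> bowtie_mul mul1 mul2 \<mu>1 \<mu>2"
abbreviation "dbr \<equiv> bowtie_br br1 br2 \<rho>1 \<rho>2"

text \<open>
  Expanding both sides gives one group of terms for each choice, per argument, of one of its two
  components. A group with three elements of \<open>V2\<close> balances by associativity, with two by compatibility of
  the products, with one because the action is multiplicative. The next lemmas proceed in the same way.
\<close>

lemma snd_mul_assoc:
  assumes "x \<in> V1" "y \<in> V1" "z \<in> V1" "a \<in> V2" "b \<in> V2" "c \<in> V2"
  shows "snd (dmul (dmul (x, a) (y, b)) (z, c)) = snd (dmul (x, a) (dmul (y, b) (z, c)))"
proof -
  note [simp] = all_closed all_distribs assms
  have "\<mu>1 (mul1 y z) a = \<mu>1 z (\<mu>1 y a)" by (simp add: A1.mul_commute[of y z] A1.\<mu>_mul)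
  moreover have "\<mu>1 x (\<mu>1 z b) = \<mu>1 z (\<mu>1 x b)"
    by (simp add: A1.mul_commute[of x z] flip: A1.\<mu>_mul)
  moreover have "\<mu>1 x (mul2 b c) = mul2 (\<mu>1 x b) c + \<mu>1 (\<mu>2 b x) c"
    by (simp add: mp_\<mu>1_mul)
  moreover have "mul2 (\<mu>1 y a) c + \<mu>1 (\<mu>2 a y) c = mul2 a (\<mu>1 y c) + \<mu>1 (\<mu>2 c y) a"
    using mp_\<mu>1_mul[of y a c] mp_\<mu>1_mul[of y c a]
    by (simp add: A2.mul_commute[of a c] A2.mul_commute[of a "\<mu>1 y c"])
  moreover have "\<mu>1 z (mul2 a b) = mul2 a (\<mu>1 z b) + \<mu>1 (\<mu>2 b z) a"
    using mp_\<mu>1_mul[of z b a] by (simp add: A2.mul_commute[of a])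
  moreover have "\<mu>1 (mul1 x y) c = \<mu>1 x (\<mu>1 y c)" by (simp add: A1.\<mu>_mul)
  moreover have "mul2 (mul2 a b) c = mul2 a (mul2 b c)" by (simp add: A2.mul_assoc)
  ultimately show ?thesis by (simp add: algebra_simps)
qed

lemma snd_jacobi:
  assumes "x \<in> V1" "y \<in> V1" "z \<in> V1" "a \<in> V2" "b \<in> V2" "c \<in> V2"
  shows "snd (dbr (x, a) (dbr (y, b) (z, c)) + dbr (y, b) (dbr (z, c) (x, a))
           + dbr (z, c) (dbr (x, a) (y, b))) = 0"
proof -
  note [simp] = all_closed all_distribs assms
  \<comment> \<open>The compatibility axiom with the value of the action second in each bracket,
     the order in which these terms arise in the expanded sum.\<close>
  have R: "\<rho>1 x (br2 a b) = - br2 b (\<rho>1 x a) + br2 a (\<rho>1 x b)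
          - \<rho>1 (\<rho>2 a x) b + \<rho>1 (\<rho>2 b x) a" if "x \<in> V1" "a \<in> V2" "b \<in> V2" for x a b
    using mp_\<rho>1_br[of x a b] that A2.br_anti[of "\<rho>1 x a" b] by (simp add: algebra_simps)
  have "br2 c (br2 a b) = - br2 a (br2 b c) - br2 b (br2 c a)"
    using A2.jacobi[of a b c] by (simp add: algebra_simps eq_neg_iff_add_eq_0)
  then show ?thesis
    by (simp add: R A1.\<rho>_br)
qed

lemma snd_rel_leibniz:
  assumes "x \<in> V1" "y \<in> V1" "z \<in> V1" "a \<in> V2" "b \<in> V2" "c \<in> V2"
  shows "snd (dbr (z, c) (dmul (x, a) (y, b))) =
      snd (dmul (dbr (z, c) (x, a)) (y, b) + dmul (x, a) (dbr (z, c) (y, b))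
        + dmul (dmul (x, a) (y, b)) (P1 z, P2 c))"
proof -
  note [simp] = all_closed all_distribs assms
  \<comment> \<open>In the correction term, compatibility of the products turns the two pieces with one
     argument in \<open>V1\<close> into the last term of the mixed bracket axiom \<open>mp_\<mu>1_br\<close>.\<close>
  have M: "mul2 (\<mu>1 y a) (P2 c) = \<mu>1 y (mul2 a (P2 c)) - \<mu>1 (\<mu>2 a y) (P2 c)"
    if "y \<in> V1" "a \<in> V2" for y a using mp_\<mu>1_mul[of y a "P2 c"] that by (simp add: algebra_simps)
  have L: "br2 c (mul2 a b) = mul2 (br2 c a) b + mul2 a (br2 c b) + mul2 (mul2 a b) (P2 c)"
    by (simp add: A2.rel_leibniz)
  have R: "\<rho>1 z (mul2 a b) = mul2 a (\<rho>1 z b) + mul2 (\<rho>1 z a) b - \<mu>1 (\<rho>2 b z) a - \<mu>1 (\<rho>2 a z) b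
       + \<mu>1 (P1 z) (mul2 a b)"
    using mp_\<rho>1_mul[of z a b] by (simp add: algebra_simps A2.mul_commute[of b "\<rho>1 z a"])
  have B: "br2 c (\<mu>1 x a) = \<rho>1 (\<mu>2 a x) c - mul2 a (\<rho>1 x c) + \<mu>1 (\<rho>2 c x) a + \<mu>1 x (br2 c a)
       + \<mu>1 x (mul2 a (P2 c))" if "x \<in> V1" "a \<in> V2" for x a
    using mp_\<mu>1_br[of x a c] that A2.br_anti[of c "\<mu>1 x a"] A2.br_anti[of c a]
    by (simp add: algebra_simps)
  have C: "\<rho>1 z (\<mu>1 x b) = \<mu>1 x (\<rho>1 z b) + \<mu>1 (br1 z x) b + \<mu>1 (mul1 x (P1 z)) b"
    if "x \<in> V1" "b \<in> V2" for x b
    using A1.rep_\<rho>_\<mu>[of x z b] that A1.br_anti[of z x]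
    by (simp add: algebra_simps)
  have K: "\<mu>1 (P1 z) (\<mu>1 x b) = \<mu>1 x (\<mu>1 (P1 z) b)" if "x \<in> V1" "b \<in> V2" for x b
    using that by (simp add: A1.mul_commute[of x] flip: A1.\<mu>_mul)
  show ?thesis
    using A1.\<rho>_mul[of x y c]
    by (simp add: M L R B C K A1.\<mu>_mul A2.mul_commute[of "\<rho>1 x c" b] A2.mul_commute[of "\<rho>1 z a" b]
       A2.mul_assoc algebra_simps)
qed

lemma snd_derivation_mul:
  assumes "x \<in> V1" "y \<in> V1" "a \<in> V2" "b \<in> V2"
  shows "P2 (snd (dmul (x, a) (y, b))) =
      snd (dmul (P1 x, P2 a) (y, b) + dmul (x, a) (P1 y, P2 b))"
  using A1.\<alpha>_\<mu>[of x b] A1.\<alpha>_\<mu>[of y a] assms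
  by (simp add: all_closed all_distribs A2.P_mul algebra_simps)

lemma snd_derivation_br:
  assumes "x \<in> V1" "y \<in> V1" "a \<in> V2" "b \<in> V2"
  shows "P2 (snd (dbr (x, a) (y, b))) =
      snd (dbr (P1 x, P2 a) (y, b) + dbr (x, a) (P1 y, P2 b))"
  using A1.\<alpha>_\<rho>[of x b] A1.\<alpha>_\<rho>[of y a] assms
  by (simp add: all_closed all_distribs A2.P_br algebra_simps)

end

lemma swap_bowtie_mul:
  "prod.swap (bowtie_mul mul1 mul2 \<mu>1 \<mu>2 u v) =
     bowtie_mul mul2 mul1 \<mu>2 \<mu>1 (prod.swap u) (prod.swap v)"
  by (cases u; cases v) simp

lemma swap_bowtie_br:
  "prod.swap (bowtie_br br1 br2 \<rho>1 \<rho>2 u v) =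
     bowtie_br br2 br1 \<rho>2 \<rho>1 (prod.swap u) (prod.swap v)"
  by (cases u; cases v) simp

lemma prod_eq_by_snd_swap: "snd u = snd v \<Longrightarrow> snd (prod.swap u) = snd (prod.swap v) \<Longrightarrow> u = v"
  by (simp add: prod_eq_iff)

lemma swap_plus: "prod.swap (u + v) = prod.swap u + prod.swap v"
  by (simp add: prod_eq_iff)

context rel_poisson_matched_pair
begin

theorem rel_poisson_algebra_bowtie:
  "rel_poisson_algebra prod.scale (V1 \<times> V2) dmul dbr (map_prod P1 P2)"
proof -
  interpret swapped: rel_poisson_matched_pair s2 V2 mul2 br2 P2 s1 V1 mul1 br1 P1 \<mu>2 \<rho>2 \<mu>1 \<rho>1
    by (rule rel_poisson_matched_pair_swap) unfold_locales
  show ?thesis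
  proof unfold_locales
    show "prod.p.subspace (V1 \<times> V2)"
      using subspace_closed by (auto simp: prod.p.subspace_def prod.scale_def zero_prod_def)
    show "bilinear_on prod.scale (V1 \<times> V2) prod.scale (V1 \<times> V2) prod.scale (V1 \<times> V2) dmul"
      by (rule bowtie_mul_bilinear)
    show "bilinear_on prod.scale (V1 \<times> V2) prod.scale (V1 \<times> V2) prod.scale (V1 \<times> V2) dbr"
      by (rule bowtie_br_bilinear)
    show "linear_on prod.scale (V1 \<times> V2) prod.scale (V1 \<times> V2) (map_prod P1 P2)"
      by (auto simp: linear_on_def prod.scale_prod A1.P_closed A2.P_closed A1.P_add A2.P_add A1.P_scale A2.P_scale)
  next
    fix u v assume "u \<in> V1 \<times> V2" "v \<in> V1 \<times> V2"
    then obtain x a y b where [simp]: "u = (x, a)" "v = (y, b)"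
      and V: "x \<in> V1" "y \<in> V1" "a \<in> V2" "b \<in> V2" by blast
    show "dmul u v = dmul v u"
      using V by (simp add: A1.mul_commute A2.mul_commute)
    show "dbr u u = 0"
      using V by (simp add: A1.br_self A2.br_self zero_prod_def)
    show "map_prod P1 P2 (dmul u v) = dmul (map_prod P1 P2 u) v + dmul u (map_prod P1 P2 v)"
      using snd_derivation_mul[OF V] swapped.snd_derivation_mul[OF V(3,4,1,2)]
      by (simp add: prod_eq_iff)
    show "map_prod P1 P2 (dbr u v) = dbr (map_prod P1 P2 u) v + dbr u (map_prod P1 P2 v)"
      using snd_derivation_br[OF V] swapped.snd_derivation_br[OF V(3,4,1,2)]
      by (simp add: prod_eq_iff)
  next
    fix u v w assume "u \<in> V1 \<times> V2" "v \<in> V1 \<times> V2" "w \<in> V1 \<times> V2"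
    then obtain x a y b z c where [simp]: "u = (x, a)" "v = (y, b)" "w = (z, c)"
      and V: "x \<in> V1" "y \<in> V1" "z \<in> V1" and W: "a \<in> V2" "b \<in> V2" "c \<in> V2" by blast
    show "dmul (dmul u v) w = dmul u (dmul v w)"
      by (rule prod_eq_by_snd_swap)
        (simp_all only: swap_bowtie_mul swap_simp \<open>u = _\<close> \<open>v = _\<close> \<open>w = _\<close>
          snd_mul_assoc[OF V W] swapped.snd_mul_assoc[OF W V])
    show "dbr u (dbr v w) + dbr v (dbr w u) + dbr w (dbr u v) = 0"
      by (rule prod_eq_by_snd_swap)
        (simp_all only: swap_bowtie_br swap_simp swap_plus \<open>u = _\<close> \<open>v = _\<close> \<open>w = _\<close>
          snd_jacobi[OF V W] swapped.snd_jacobi[OF W V] zero_prod_def snd_conv)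
    show "dbr w (dmul u v) = dmul (dbr w u) v + dmul u (dbr w v) + dmul (dmul u v) (map_prod P1 P2 w)"
      by (rule prod_eq_by_snd_swap)
        (simp_all only: swap_bowtie_br swap_bowtie_mul swap_simp swap_plus map_prod_simp
          \<open>u = _\<close> \<open>v = _\<close> \<open>w = _\<close> snd_rel_leibniz[OF V W] swapped.snd_rel_leibniz[OF W V])
  qed
qed

end

context rel_poisson_pair
begin

text \<open>
  Every axiom of a matched pair is a component of an axiom of the direct sum, evaluated at elements of
  the summands. The mixed cases of associativity come first, because the Leibniz rule yields the
  factors \<open>P1 y\<close> and \<open>P2 b\<close> in a different association than the representation and matched-pair axioms.
\<close>

theorem matched_pair_of_bowtie:
  assumes "rel_poisson_algebra prod.scale (V1 \<times> V2) (bowtie_mul mul1 mul2 \<mu>1 \<mu>2)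
             (bowtie_br br1 br2 \<rho>1 \<rho>2) (map_prod P1 P2)"
  shows "rel_poisson_matched_pair s1 V1 mul1 br1 P1 s2 V2 mul2 br2 P2 \<mu>1 \<rho>1 \<mu>2 \<rho>2"
proof -
  interpret D: rel_poisson_algebra prod.scale "V1 \<times> V2" "bowtie_mul mul1 mul2 \<mu>1 \<mu>2"
    "bowtie_br br1 br2 \<rho>1 \<rho>2" "map_prod P1 P2" by fact
  note [simp] = all_closed all_distribs all_zeros
  have \<mu>1_mul: "\<mu>1 (mul1 x y) a = \<mu>1 x (\<mu>1 y a)"
    and mp_\<mu>2: "\<mu>2 a (mul1 x y) = mul1 (\<mu>2 a x) y + \<mu>2 (\<mu>1 x a) y"
    if "x \<in> V1" "y \<in> V1" "a \<in> V2" for x y a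
    using that D.mul_assoc[of "(x, 0)" "(y, 0)" "(0, a)"]
      D.mul_assoc[of "(0, a)" "(x, 0)" "(y, 0)"] by simp_all
  have \<mu>2_mul: "\<mu>2 (mul2 a b) x = \<mu>2 a (\<mu>2 b x)"
    and mp_\<mu>1: "\<mu>1 x (mul2 a b) = mul2 (\<mu>1 x a) b + \<mu>1 (\<mu>2 a x) b"
    if "x \<in> V1" "a \<in> V2" "b \<in> V2" for x a b
    using that D.mul_assoc[of "(0, a)" "(0, b)" "(x, 0)"]
      D.mul_assoc[of "(x, 0)" "(0, a)" "(0, b)"] by simp_all
  show ?thesis
  proof unfold_locales
    show "linear_on s1 V1 s1 V1 P1" "linear_on s2 V2 s2 V2 P2"
      by (rule A1.P_linear A2.P_linear)+
  next
    fix x y a assume V: "x \<in> V1" "y \<in> V1" "a \<in> V2"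
    show "\<mu>1 (mul1 x y) a = \<mu>1 x (\<mu>1 y a)"
      "\<mu>2 a (mul1 x y) = mul1 (\<mu>2 a x) y + \<mu>2 (\<mu>1 x a) y"
      using V by (rule \<mu>1_mul mp_\<mu>2)+
    note jacobi = D.jacobi[of "(x, 0)" "(y, 0)" "(0, a)"]
    show "\<rho>1 (br1 x y) a = \<rho>1 x (\<rho>1 y a) - \<rho>1 y (\<rho>1 x a)"
      using jacobi V by (simp add: algebra_simps eq_neg_iff_add_eq_0 zero_prod_def)
    show "\<rho>2 a (br1 x y) - br1 (\<rho>2 a x) y - br1 x (\<rho>2 a y)
          + \<rho>2 (\<rho>1 x a) y - \<rho>2 (\<rho>1 y a) x = 0"
      using jacobi V A1.br_anti[of y "\<rho>2 a x"]
      by (simp add: algebra_simps eq_neg_iff_add_eq_0 zero_prod_def)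
    note leibniz = D.rel_leibniz[of "(x, 0)" "(0, a)" "(y, 0)"]
    show "\<rho>1 y (\<mu>1 x a) - \<mu>1 x (\<rho>1 y a) + \<mu>1 (br1 x y) a - \<mu>1 (mul1 x (P1 y)) a = 0"
      using leibniz V A1.br_anti[of x y] \<mu>1_mul[of "P1 y" x a] A1.mul_commute[of "P1 y" x]
      by (simp add: algebra_simps)
    show "\<rho>2 (\<mu>1 x a) y + br1 (\<mu>2 a x) y - mul1 x (\<rho>2 a y)
          + \<mu>2 (\<rho>1 y a) x - \<mu>2 a (br1 x y) + \<mu>2 a (mul1 x (P1 y)) = 0"
      using leibniz V mp_\<mu>2[of x "P1 y" a] A1.br_anti[of y] by (simp add: algebra_simps)
    note leibniz = D.rel_leibniz[of "(x, 0)" "(y, 0)" "(0, a)"]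
    show "\<rho>1 (mul1 x y) a - \<mu>1 x (\<rho>1 y a) - \<mu>1 y (\<rho>1 x a) + \<mu>1 (mul1 x y) (P2 a) = 0"
      using leibniz V by (simp add: algebra_simps)
    show "\<rho>2 a (mul1 x y) + \<mu>2 (\<rho>1 y a) x - mul1 x (\<rho>2 a y)
          + \<mu>2 (\<rho>1 x a) y - mul1 y (\<rho>2 a x) - \<mu>2 (P2 a) (mul1 x y) = 0"
      using leibniz V A1.mul_commute[of y "\<rho>2 a x"] by (simp add: algebra_simps)
  next
    fix a b x assume V: "a \<in> V2" "b \<in> V2" "x \<in> V1"
    show "\<mu>2 (mul2 a b) x = \<mu>2 a (\<mu>2 b x)" using V by (simp add: \<mu>2_mul)
    note jacobi = D.jacobi[of "(0, a)" "(0, b)" "(x, 0)"]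
    show "\<rho>2 (br2 a b) x = \<rho>2 a (\<rho>2 b x) - \<rho>2 b (\<rho>2 a x)"
      using jacobi V by (simp add: algebra_simps eq_neg_iff_add_eq_0 zero_prod_def)
    note leibniz = D.rel_leibniz[of "(x, 0)" "(0, a)" "(0, b)"]
    show "\<rho>2 b (\<mu>2 a x) - \<mu>2 a (\<rho>2 b x) + \<mu>2 (br2 a b) x - \<mu>2 (mul2 a (P2 b)) x = 0"
      using leibniz V A2.br_anti[of a b] \<mu>2_mul[of x "P2 b" a] A2.mul_commute[of "P2 b" a]
      by (simp add: algebra_simps)
    note leibniz = D.rel_leibniz[of "(0, a)" "(0, b)" "(x, 0)"]
    show "\<rho>2 (mul2 a b) x - \<mu>2 a (\<rho>2 b x) - \<mu>2 b (\<rho>2 a x) + \<mu>2 (mul2 a b) (P1 x) = 0"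
      using leibniz V by (simp add: algebra_simps)
  next
    fix x a b assume V: "x \<in> V1" "a \<in> V2" "b \<in> V2"
    show "\<mu>1 x (mul2 a b) = mul2 (\<mu>1 x a) b + \<mu>1 (\<mu>2 a x) b"
      using V by (rule mp_\<mu>1)
    note jacobi = D.jacobi[of "(0, a)" "(0, b)" "(x, 0)"]
    show "\<rho>1 x (br2 a b) - br2 (\<rho>1 x a) b - br2 a (\<rho>1 x b)
          + \<rho>1 (\<rho>2 a x) b - \<rho>1 (\<rho>2 b x) a = 0"
      using jacobi V A2.br_anti[of b "\<rho>1 x a"]
      by (simp add: algebra_simps eq_neg_iff_add_eq_0 zero_prod_def)
    note leibniz = D.rel_leibniz[of "(x, 0)" "(0, a)" "(0, b)"]
    show "\<rho>1 (\<mu>2 a x) b + br2 (\<mu>1 x a) b - mul2 a (\<rho>1 x b)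
          + \<mu>1 (\<rho>2 b x) a - \<mu>1 x (br2 a b) + \<mu>1 x (mul2 a (P2 b)) = 0"
      using leibniz V mp_\<mu>1[of x a "P2 b"] A2.br_anti[of b] A2.mul_commute[of a "\<rho>1 x b"]
      by (simp add: algebra_simps)
    note leibniz = D.rel_leibniz[of "(0, a)" "(0, b)" "(x, 0)"]
    show "\<rho>1 x (mul2 a b) + \<mu>1 (\<rho>2 b x) a - mul2 a (\<rho>1 x b)
          + \<mu>1 (\<rho>2 a x) b - mul2 b (\<rho>1 x a) - \<mu>1 (P1 x) (mul2 a b) = 0"
      using leibniz V A2.mul_commute[of b "\<rho>1 x a"] by (simp add: algebra_simps)
  next
    fix x a assume V: "x \<in> V1" "a \<in> V2"
    note P = D.P_mul[of "(x, 0)" "(0, a)"] D.P_br[of "(x, 0)" "(0, a)"]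
    show "P2 (\<mu>1 x a) - \<mu>1 (P1 x) a - \<mu>1 x (P2 a) = 0"
      "P2 (\<rho>1 x a) - \<rho>1 (P1 x) a - \<rho>1 x (P2 a) = 0"
      using V P by (simp_all add: algebra_simps)
  next
    fix a x assume V: "a \<in> V2" "x \<in> V1"
    note P = D.P_mul[of "(0, a)" "(x, 0)"] D.P_br[of "(0, a)" "(x, 0)"]
    show "P1 (\<mu>2 a x) - \<mu>2 (P2 a) x - \<mu>2 a (P1 x) = 0"
      "P1 (\<rho>2 a x) - \<rho>2 (P2 a) x - \<rho>2 a (P1 x) = 0"
      using V P by (simp_all add: algebra_simps)
  qed (rule A1.subspace_carrier A2.subspace_carrier
      \<mu>1_bilinear \<mu>2_bilinear \<rho>1_bilinear \<rho>2_bilinear)+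
qed

theorem matched_pair_iff_bowtie:
  "rel_poisson_matched_pair s1 V1 mul1 br1 P1 s2 V2 mul2 br2 P2 \<mu>1 \<rho>1 \<mu>2 \<rho>2 \<longleftrightarrow>
   rel_poisson_algebra prod.scale (V1 \<times> V2) (bowtie_mul mul1 mul2 \<mu>1 \<mu>2)
     (bowtie_br br1 br2 \<rho>1 \<rho>2) (map_prod P1 P2)"
  using matched_pair_of_bowtie rel_poisson_matched_pair.rel_poisson_algebra_bowtie by blast

end

section \<open>Duality in finite dimension\<close>

lemma dual_map_apply [simp]: "dual_map T f x = f (T x)"
  by (simp add: dual_map_def)

lemma dual_map_id [simp]: "dual_map id f = f"
  by (simp add: dual_map_def fun_eq_iff)

lemma sum_apply: "(\<Sum>i\<in>I. g i) x = (\<Sum>i\<in>I. g i x)"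
  for g :: "'i \<Rightarrow> 'x \<Rightarrow> 'y::comm_monoid_add"
  by (induction I rule: infinite_finite_induct) simp_all

text \<open>
  The operations of a Manin triple are constrained on the carrier only, so they can be identified
  with given operations there and not as functions.
\<close>

lemma rel_poisson_algebra_cong:
  assumes "rel_poisson_algebra s V mul br P"
    and "\<And>x y. \<lbrakk>x \<in> V; y \<in> V\<rbrakk> \<Longrightarrow> mul' x y = mul x y"
    and "\<And>x y. \<lbrakk>x \<in> V; y \<in> V\<rbrakk> \<Longrightarrow> br' x y = br x y"
  shows "rel_poisson_algebra s V mul' br' P"
proof -
  interpret rel_poisson_algebra s V mul br P by fact
  have bilinear: "bilinear_on s V s V s V mul'" "bilinear_on s V s V s V br'"
    using mul_bilinear br_bilinear by (simp_all add: bilinear_on_def linear_on_def assms subspace_closed)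
  show ?thesis
    using mul_commute mul_assoc br_self jacobi P_mul P_br rel_leibniz
    by unfold_locales
      (simp_all add: assms mul.closed br.closed P_closed bilinear P_linear subspace_carrier
        subspace_closed)
qed

context vector_space
begin

lemma in_dual_iff: "f \<in> dual scale \<longleftrightarrow> (\<forall>x y. f (x + y) = f x + f y) \<and> (\<forall>c x. f (scale c x) = c * f x)"
proof
  assume "f \<in> dual scale"
  then interpret f: Vector_Spaces.linear scale "(*)" f by (simp add: dual_def)
  show "(\<forall>x y. f (x + y) = f x + f y) \<and> (\<forall>c x. f (scale c x) = c * f x)"
    by (simp add: f.add f.scale)
next
  assume "(\<forall>x y. f (x + y) = f x + f y) \<and> (\<forall>c x. f (scale c x) = c * f x)"
  then show "f \<in> dual scale"
    unfolding dual_def mem_Collect_eq by unfold_locales (simp_all add: algebra_simps)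
qed

lemma dual_add: "f \<in> dual scale \<Longrightarrow> f (x + y) = f x + f y"
  and dual_scale: "f \<in> dual scale \<Longrightarrow> f (scale c x) = c * f x"
  by (simp_all add: in_dual_iff)

lemma dual_diff: "f \<in> dual scale \<Longrightarrow> f (x - y) = f x - f y"
  using dual_add[of f "x - y" y] by simp

lemma dual_zero: "f \<in> dual scale \<Longrightarrow> f 0 = 0"
  using dual_diff[of f 0 0] by simp

lemma dual_minus: "f \<in> dual scale \<Longrightarrow> f (- x) = - f x"
  using dual_diff[of f 0 x] by (simp add: dual_zero)

lemma dual_sum: "f \<in> dual scale \<Longrightarrow> f (\<Sum>i\<in>I. g i) = (\<Sum>i\<in>I. f (g i))"
  by (induction I rule: infinite_finite_induct) (simp_all add: dual_add dual_zero)

end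

context finite_dimensional_vector_space
begin

lemma coordinate_in_dual: "(\<lambda>v. representation Basis v b) \<in> dual scale"
  unfolding dual_def mem_Collect_eq
  by (rule linear_representation[OF independent_Basis span_Basis])

lemma sum_coordinates: "(\<Sum>b\<in>Basis. scale (representation Basis v b) b) = v"
  by (rule sum_representation_eq[OF independent_Basis _ finite_Basis order_refl])
    (simp add: span_Basis)

lemma dual_separates:
  assumes "\<And>f. f \<in> dual scale \<Longrightarrow> f x = f y"
  shows "x = y"
proof -
  have "representation Basis x b = representation Basis y b" for b
    using assms[OF coordinate_in_dual] .
  then have "(\<Sum>b\<in>Basis. scale (representation Basis x b) b) =
      (\<Sum>b\<in>Basis. scale (representation Basis y b) b)" by simp
  then show ?thesis
    by (simp only: sum_coordinates)
qed

text \<open>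
  The vector representing \<open>\<phi>\<close> has the values of \<open>\<phi>\<close> on the dual basis as its coordinates.
\<close>

lemma dual_reflexive:
  assumes "linear_on dscale (dual scale) (*) UNIV \<phi>"
  shows "\<exists>!w. \<forall>f\<in>dual scale. f w = \<phi> f"
proof (rule ex_ex1I)
  let ?c = "\<lambda>b v. representation Basis v b"
  interpret F: vector_space "dscale :: 'a \<Rightarrow> ('b \<Rightarrow> 'a) \<Rightarrow> 'b \<Rightarrow> 'a" by (rule vector_space_dscale)
  have sub: "F.subspace (dual scale)"
    by (auto simp: F.subspace_def in_dual_iff dscale_def algebra_simps)
  have \<phi>_sum: "\<phi> (\<Sum>b\<in>B. g b) = (\<Sum>b\<in>B. \<phi> (g b))" if "\<And>b. g b \<in> dual scale" for g :: "'b \<Rightarrow> _" and B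
  proof (induction B rule: infinite_finite_induct)
    case (insert b B)
    have "\<phi> (g b + sum g B) = \<phi> (g b) + \<phi> (sum g B)"
      using assms that F.subspace_sum[OF sub, of B g] unfolding linear_on_def by blast
    with insert show ?case by (simp only: sum.insert[OF insert.hyps(1,2)])
  next
    have "\<phi> (0 + 0) = \<phi> 0 + \<phi> 0"
      using assms F.subspace_0[OF sub] unfolding linear_on_def by blast
    then have *: "\<phi> 0 = 0" by (metis add.right_neutral add_left_cancel)
    { case empty then show ?case by (simp only: sum.empty *) }
    { case (infinite B) then show ?case by (simp only: sum.infinite[OF infinite] *) }
  qed
  have "f (\<Sum>b\<in>Basis. scale (\<phi> (?c b)) b) = \<phi> f" if f: "f \<in> dual scale" for f
  proof -
    have "f = (\<Sum>b\<in>Basis. dscale (f b) (?c b))"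
    proof
      fix v
      have "f v = f (\<Sum>b\<in>Basis. scale (?c b v) b)" by (simp only: sum_coordinates)
      also have "\<dots> = (\<Sum>b\<in>Basis. dscale (f b) (?c b) v)"
        by (simp only: dual_sum[OF f] dual_scale[OF f] dscale_def mult.commute)
      finally show "f v = (\<Sum>b\<in>Basis. dscale (f b) (?c b)) v" by (simp only: sum_apply)
    qed
    moreover have "\<phi> (\<Sum>b\<in>Basis. dscale (f b) (?c b)) = (\<Sum>b\<in>Basis. \<phi> (dscale (f b) (?c b)))"
      by (rule \<phi>_sum) (rule F.subspace_scale[OF sub coordinate_in_dual])
    ultimately have "\<phi> f = (\<Sum>b\<in>Basis. \<phi> (dscale (f b) (?c b)))" by (simp only:)
    also have "\<dots> = (\<Sum>b\<in>Basis. f b * \<phi> (?c b))"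
      using assms by (simp add: linear_on_def coordinate_in_dual)
    finally show ?thesis
      by (simp add: dual_sum f dual_scale mult.commute)
  qed
  then show "\<exists>w. \<forall>f\<in>dual scale. f w = \<phi> f" by blast
next
  fix v w assume "\<forall>f\<in>dual scale. f v = \<phi> f" "\<forall>f\<in>dual scale. f w = \<phi> f"
  then show "v = w" by (intro dual_separates) simp
qed

text \<open>
  The description by which \<open>predual_act\<close> is defined is realised, so from here on the preduals enter only
  through their pairing with linear forms.
\<close>

lemma pairing_predual_act:
  assumes "linear_on dscale (dual scale) (*) UNIV (\<lambda>f. \<phi> x f v)" "f \<in> dual scale"
  shows "f (predual_act scale \<phi> x v) = - \<phi> x f v"
proof -
  have "linear_on dscale (dual scale) (*) UNIV (\<lambda>f. - \<phi> x f v)"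
    using assms(1) by (simp add: linear_on_def)
  from theI'[OF dual_reflexive[OF this]] assms(2) show ?thesis
    by (simp add: predual_act_def)
qed

end

section \<open>An algebra and a compatible coalgebra\<close>

locale rel_poisson_dual_pair =
  finite_dimensional_vector_space s Basis +
  A: rel_poisson_algebra s UNIV mul br P +
  C: rel_poisson_coalgebra s \<Delta> \<delta> Q +
  D: rel_poisson_algebra dscale "dual s" mul' br' "dual_map Q"
  for s :: "'k::field \<Rightarrow> 'a::ab_group_add \<Rightarrow> 'a" and Basis
    and mul br :: "'a \<Rightarrow> 'a \<Rightarrow> 'a" and P Q :: "'a \<Rightarrow> 'a"
    and \<Delta> \<delta> :: "'a \<Rightarrow> ('a \<Rightarrow> 'k) \<Rightarrow> ('a \<Rightarrow> 'k) \<Rightarrow> 'k"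
    and mul' br' :: "('a \<Rightarrow> 'k) \<Rightarrow> ('a \<Rightarrow> 'k) \<Rightarrow> 'a \<Rightarrow> 'k" +
  assumes mul'_eq: "\<lbrakk>f \<in> dual s; g \<in> dual s\<rbrakk> \<Longrightarrow> mul' f g = dual_map \<Delta> (dual_tensor f g)"
    and br'_eq: "\<lbrakk>f \<in> dual s; g \<in> dual s\<rbrakk> \<Longrightarrow> br' f g = dual_map \<delta> (dual_tensor f g)"
begin

lemma dual_closed:
  "f \<in> dual s \<Longrightarrow> g \<in> dual s \<Longrightarrow> f + g \<in> dual s"
  "f \<in> dual s \<Longrightarrow> g \<in> dual s \<Longrightarrow> f - g \<in> dual s"
  "f \<in> dual s \<Longrightarrow> - f \<in> dual s"
  "f \<in> dual s \<Longrightarrow> dscale c f \<in> dual s"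
  "0 \<in> dual s"
  by (simp_all add: D.subspace_closed)

lemma Q_add: "Q (x + y) = Q x + Q y" and Q_scale: "Q (s c x) = s c (Q x)"
proof -
  interpret Q: Vector_Spaces.linear s s Q by (rule C.Q_linear)
  show "Q (x + y) = Q x + Q y" "Q (s c x) = s c (Q x)"
    by (simp_all add: Q.add Q.scale)
qed

lemma dual_map_closed:
  assumes "f \<in> dual s"
  shows "dual_map (mul x) f \<in> dual s" "dual_map (br x) f \<in> dual s"
    "dual_map P f \<in> dual s" "dual_map Q f \<in> dual s"
  using assms by (simp_all add: in_dual_iff A.mul.add_right A.mul.scale_right A.br.add_right A.br.scale_right
      A.P_add A.P_scale Q_add Q_scale)

lemma \<Delta>_apply: "\<lbrakk>f \<in> dual s; g \<in> dual s\<rbrakk> \<Longrightarrow> \<Delta> x f g = mul' f g x"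
  and \<delta>_apply: "\<lbrakk>f \<in> dual s; g \<in> dual s\<rbrakk> \<Longrightarrow> \<delta> x f g = br' f g x"
  by (simp_all add: mul'_eq br'_eq dual_tensor_def)

lemma pairing_predual_mul':
  "\<lbrakk>f \<in> dual s; g \<in> dual s\<rbrakk> \<Longrightarrow> g (predual_act s mul' f x) = - mul' f g x"
  by (rule pairing_predual_act[where \<phi> = mul' and x = f and v = x and f = g])
    (simp_all add: linear_on_def D.mul.add_right D.mul.scale_right, simp add: dscale_def)

lemma pairing_predual_br':
  "\<lbrakk>f \<in> dual s; g \<in> dual s\<rbrakk> \<Longrightarrow> g (predual_act s br' f x) = - br' f g x"
  by (rule pairing_predual_act[where \<phi> = br' and x = f and v = x and f = g])
    (simp_all add: linear_on_def D.br.add_right D.br.scale_right, simp add: dscale_def)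

text \<open>
  Transposes without sign are the normal form for actions on the dual: they compose with the
  product and the bracket of the dual without sign bookkeeping.
\<close>

lemma dual_act_eq: "dual_act \<phi> x f = - dual_map (\<phi> x) f"
  by (simp add: dual_act_def fun_eq_iff)

abbreviation "coad_mul \<equiv> - dual_act mul"
abbreviation "coad_br \<equiv> dual_act br"
abbreviation "coad_mul' \<equiv> - predual_act s mul'"
abbreviation "coad_br' \<equiv> predual_act s br'"
abbreviation "double_mul \<equiv> bowtie_mul mul mul' coad_mul coad_mul'"
abbreviation "double_br \<equiv> bowtie_br br br' coad_br coad_br'"

lemma coadjoint_bilinear:
  "bilinear_on s UNIV dscale (dual s) dscale (dual s) coad_mul"
  "bilinear_on s UNIV dscale (dual s) dscale (dual s) coad_br"
  unfolding bilinear_on_def linear_on_def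
  by (auto simp: dual_act_eq dual_map_closed dual_closed)
    (auto simp: fun_eq_iff dscale_def A.mul.add_left A.mul.scale_left A.br.add_left A.br.scale_left
       dual_add dual_scale)

lemma predual_bilinear:
  "bilinear_on dscale (dual s) s UNIV s UNIV coad_mul'"
  "bilinear_on dscale (dual s) s UNIV s UNIV coad_br'"
  unfolding bilinear_on_def linear_on_def
  by (auto intro!: dual_separates simp: pairing_predual_mul' pairing_predual_br' dual_closed
      dual_add dual_diff dual_scale dual_minus D.mul.add_left D.mul.scale_left D.br.add_left D.br.scale_left
      dual_add[OF D.mul.closed] dual_add[OF D.br.closed]
      dual_scale[OF D.mul.closed] dual_scale[OF D.br.closed])
    (auto simp: dscale_def)

sublocale pair: rel_poisson_pair s UNIV mul br P dscale "dual s" mul' br' "dual_map Q"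
  coad_mul coad_br coad_mul' coad_br'
  by unfold_locales (rule coadjoint_bilinear predual_bilinear)+

section \<open>Manin triples\<close>

text \<open>
  The right-hand side is symmetric under all permutations of the three arguments; this is the
  invariance of the form. For the bracket below the expression is alternating instead.
\<close>

lemma B_d_double_mul:
  assumes "f \<in> dual s" "g \<in> dual s" "h \<in> dual s"
  shows "B_d (double_mul (x, f) (y, g)) (z, h) =
    h (mul x y) + mul' f h y + mul' g h x + mul' f g z + g (mul x z) + f (mul y z)"
  using assms
  by (simp add: B_d_def dual_act_eq pairing_predual_mul' dual_add dual_diff)

lemma B_d_double_br:
  assumes "f \<in> dual s" "g \<in> dual s" "h \<in> dual s"
  shows "B_d (double_br (x, f) (y, g)) (z, h) =
    h (br x y) - br' f h y + br' g h x + br' f g z - g (br x z) + f (br y z)"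
  using assms
  by (simp add: B_d_def dual_act_eq pairing_predual_br' dual_add dual_diff)

lemma B_d_commute: "B_d u v = B_d v u"
  by (simp add: B_d_def add.commute)

lemma B_d_nondegenerate:
  assumes "u \<in> UNIV \<times> dual s" "v \<in> UNIV \<times> dual s"
    and B: "\<And>w. w \<in> UNIV \<times> dual s \<Longrightarrow> B_d u w = B_d v w"
  shows "u = v"
proof (rule prod_eqI)
  show "fst u = fst v"
    by (rule dual_separates) (use B[of "(0, _)"] assms in \<open>auto simp: B_d_def dual_zero\<close>)
  show "snd u = snd v"
    using B[of "(_, 0)"] by (auto simp: B_d_def dual_closed fun_eq_iff)
qed

theorem manin_triple_iff_double:
  "(\<exists>M N. rel_poisson_manin_triple s mul br P mul' br' Q M N) \<longleftrightarrow>
   rel_poisson_algebra pair.prod.scale (UNIV \<times> dual s) double_mul double_br (map_prod P (dual_map Q))"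
proof
  assume dbl: "rel_poisson_algebra pair.prod.scale (UNIV \<times> dual s) double_mul double_br
    (map_prod P (dual_map Q))"
  have "rel_poisson_manin_triple s mul br P mul' br' Q double_mul double_br"
  proof (intro rel_poisson_manin_triple.intro rel_poisson_manin_triple_axioms.intro dbl
      A.rel_poisson_algebra_axioms D.rel_poisson_algebra_axioms)
    show "subalgebra_via (\<lambda>x. (x, 0)) UNIV mul br P double_mul double_br (map_prod P (dual_map Q))"
      by (simp add: subalgebra_via_def pair.all_zeros dual_closed del: uminus_apply)
    show "subalgebra_via (\<lambda>f. (0, f)) (dual s) mul' br' (dual_map Q) double_mul double_br
        (map_prod P (dual_map Q))"
      by (simp add: subalgebra_via_def pair.all_zeros dual_closed del: uminus_apply)
    fix u v w :: "'a \<times> ('a \<Rightarrow> 'k)"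
    assume "u \<in> UNIV \<times> dual s" "v \<in> UNIV \<times> dual s" "w \<in> UNIV \<times> dual s"
    then obtain x f y g z h where [simp]: "u = (x, f)" "v = (y, g)" "w = (z, h)"
      and [simp]: "f \<in> dual s" "g \<in> dual s" "h \<in> dual s" by blast
    show "B_d (double_mul u v) w = B_d u (double_mul v w)"
      using A.mul_commute[of z x] A.mul_commute[of z y] A.mul_commute[of x y]
        D.mul_commute[of h f] D.mul_commute[of h g] D.mul_commute[of f g]
      by (simp add: B_d_commute[of "(x, f)"] B_d_double_mul del: bowtie_mul_apply)
    show "B_d (double_br u v) w = B_d u (double_br v w)"
      using A.br_anti[of z x] A.br_anti[of z y] A.br_anti[of x y]
        D.br_anti[of h f] D.br_anti[of h g] D.br_anti[of f g]
      by (simp add: B_d_commute[of "(x, f)"] B_d_double_br dual_minus del: bowtie_br_apply)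
  qed
  then show "\<exists>M N. rel_poisson_manin_triple s mul br P mul' br' Q M N" by blast
next
  assume "\<exists>M N. rel_poisson_manin_triple s mul br P mul' br' Q M N"
  then obtain M N where "rel_poisson_manin_triple s mul br P mul' br' Q M N" by blast
  then interpret T: rel_poisson_manin_triple s mul br P mul' br' Q M N .
  note [simp] = dual_closed dual_zero
  have B_add: "B_d (u + v) w = B_d u w + B_d v w" "B_d w (u + v) = B_d w u + B_d w v"
    if "w \<in> UNIV \<times> dual s" for u v w
    using that by (auto simp: B_d_def dual_add)
  have pure: "M (x, 0) (y, 0) = (mul x y, 0)" "N (x, 0) (y, 0) = (br x y, 0)" for x y
    using T.sub_A by (simp_all add: subalgebra_via_def)
  have pure': "M (0, f) (0, g) = (0, mul' f g)" "N (0, f) (0, g) = (0, br' f g)"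
    if "f \<in> dual s" "g \<in> dual s" for f g
    using T.sub_dual that by (simp_all add: subalgebra_via_def)
  have split: "(x, f) = (x, 0) + (0, f)" for x :: 'a and f :: "'a \<Rightarrow> 'k" by simp
  \<comment> \<open>Tested against \<open>A\<close>, invariance moves \<open>x\<close> to the other side, where only the product of \<open>A\<close> is
     involved; tested against the dual, it moves \<open>g\<close>, where only the product of the dual is involved.\<close>
  have M_mixed: "B_d (M (x, 0) (0, g)) (z, h) = g (mul x z) + mul' g h x"
    if [simp]: "g \<in> dual s" "h \<in> dual s" for x z g h
  proof -
    have "B_d (M (x, 0) (0, g)) (z, 0) = B_d (M (0, g) (x, 0)) (z, 0)"
      by (simp add: T.mul_commute)
    also have "\<dots> = g (mul x z)"
      by (simp add: T.invariant_mul pure) (simp add: B_d_def)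
    finally have "B_d (M (x, 0) (0, g)) (z, 0) = g (mul x z)" .
    moreover have "B_d (M (x, 0) (0, g)) (0, h) = mul' g h x"
      by (simp add: T.invariant_mul pure') (simp add: B_d_def)
    ultimately show ?thesis
      using T.mul.closed[of "(x, 0)" "(0, g)"] by (subst split[of z]) (simp add: B_add del: add_Pair)
  qed
  have N_mixed: "B_d (N (x, 0) (0, g)) (z, h) = - g (br x z) + br' g h x"
    if [simp]: "g \<in> dual s" "h \<in> dual s" for x z g h
  proof -
    have "B_d (N (x, 0) (0, g)) (z, 0) = - B_d (N (0, g) (x, 0)) (z, 0)"
      by (simp add: T.br_anti[of "(x, 0)"]) (simp add: B_d_def)
    also have "\<dots> = - g (br x z)"
      by (simp add: T.invariant_br pure) (simp add: B_d_def)
    finally have "B_d (N (x, 0) (0, g)) (z, 0) = - g (br x z)" .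
    moreover have "B_d (N (x, 0) (0, g)) (0, h) = br' g h x"
      by (simp add: T.invariant_br pure') (simp add: B_d_def)
    ultimately show ?thesis
      using T.br.closed[of "(x, 0)" "(0, g)"] by (subst split[of z]) (simp add: B_add del: add_Pair)
  qed
  have M_eq: "double_mul u v = M u v" and N_eq: "double_br u v = N u v"
    if uv: "u \<in> UNIV \<times> dual s" "v \<in> UNIV \<times> dual s" for u v
  proof -
    obtain x f y g where [simp]: "u = (x, f)" "v = (y, g)" "f \<in> dual s" "g \<in> dual s"
      using uv by blast
    have M_sum: "M u v = (mul x y, 0) + M (x, 0) (0, g) + M (y, 0) (0, f) + (0, mul' f g)"
      by (simp add: split[of x f] split[of y g] mem_Times_iff T.mul.distribs pure pure'
            T.mul_commute[of "(0, f)"]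
          del: add_Pair)
    have N_sum: "N u v = (br x y, 0) + N (x, 0) (0, g) - N (y, 0) (0, f) + (0, br' f g)"
      by (simp add: split[of x f] split[of y g] mem_Times_iff T.br.distribs pure pure'
            T.br_anti[of "(0, f)" "(y, 0)"]
          del: add_Pair)
    have B_diff: "B_d (p - q) w = B_d p w - B_d q w" if "w \<in> UNIV \<times> dual s" for p q w
      using that B_add(1)[of w "p - q" q] by simp
    show "double_mul u v = M u v"
    proof (rule B_d_nondegenerate)
      fix w :: "'a \<times> ('a \<Rightarrow> 'k)" assume w: "w \<in> UNIV \<times> dual s"
      then obtain z h where [simp]: "w = (z, h)" "h \<in> dual s" by blast
      show "B_d (double_mul u v) w = B_d (M u v) w"
        unfolding M_sum using w
        by (simp add: B_add M_mixed B_d_double_mul del: bowtie_mul_apply add_Pair) (simp add: B_d_def)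
    qed (use uv T.mul.closed in \<open>auto simp: pair.all_closed dual_act_eq dual_closed dual_map_closed\<close>)
    show "double_br u v = N u v"
    proof (rule B_d_nondegenerate)
      fix w :: "'a \<times> ('a \<Rightarrow> 'k)" assume w: "w \<in> UNIV \<times> dual s"
      then obtain z h where [simp]: "w = (z, h)" "h \<in> dual s" by blast
      show "B_d (double_br u v) w = B_d (N u v) w"
        unfolding N_sum using w
        by (simp add: B_add B_diff N_mixed B_d_double_br del: bowtie_br_apply add_Pair) (simp add: B_d_def)
    qed (use uv T.br.closed in \<open>auto simp: pair.all_closed dual_act_eq dual_closed dual_map_closed\<close>)
  qed
  show "rel_poisson_algebra pair.prod.scale (UNIV \<times> dual s) double_mul double_br
    (map_prod P (dual_map Q))"
    by (rule rel_poisson_algebra_cong[OF T.rel_poisson_algebra_axioms M_eq N_eq])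
qed

section \<open>The bialgebra conditions as scalar identities\<close>

lemma tensor_square_off_dual:
  assumes "t \<in> tensor_square s" "f \<notin> dual s \<or> g \<notin> dual s"
  shows "t f g = 0"
proof -
  interpret T: vector_space "tscale2 :: 'k \<Rightarrow> (('a \<Rightarrow> 'k) \<Rightarrow> ('a \<Rightarrow> 'k) \<Rightarrow> 'k) \<Rightarrow> _"
    by (rule vector_space_tscale2)
  show ?thesis
    using assms(1) unfolding tensor_square_def
    by (induction rule: T.span_induct_alt)
      (use assms(2) in \<open>auto simp: tensor2_def on_dual2_def tscale2_def\<close>)
qed

text \<open>
  Tensors are extended by 0, so the values on the dual decide equality as soon as both sides vanish
  elsewhere.
\<close>

lemma \<Delta>_off_dual: "f \<notin> dual s \<or> g \<notin> dual s \<Longrightarrow> \<Delta> x f g = 0"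
  and \<delta>_off_dual: "f \<notin> dual s \<or> g \<notin> dual s \<Longrightarrow> \<delta> x f g = 0"
  by (rule tensor_square_off_dual[OF C.\<Delta>_range], assumption)
    (rule tensor_square_off_dual[OF C.\<delta>_range], assumption)

lemma tens_id_\<Delta>_apply:
  "tens_id s \<Delta> (\<Delta> x) f g h =
     (if f \<in> dual s \<and> g \<in> dual s \<and> h \<in> dual s then mul' (mul' f g) h x else 0)"
  using D.mul.closed[of f g] by (simp add: tens_id_def on_dual3_def \<Delta>_apply flip: mul'_eq)

lemma tensor_eq_iff:
  assumes "\<And>f g. f \<notin> dual s \<or> g \<notin> dual s \<Longrightarrow> t f g = t' f g"
  shows "t = t' \<longleftrightarrow> (\<forall>f\<in>dual s. \<forall>g\<in>dual s. t f g = t' f g)"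
  using assms by (auto simp: fun_eq_iff)

lemma \<Delta>_P_iff: "\<Delta> (P x) = tmap s P id (\<Delta> x) - tmap s id Q (\<Delta> x) \<longleftrightarrow>
    (\<forall>f\<in>dual s. \<forall>g\<in>dual s. mul' f g (P x) = mul' (dual_map P f) g x - mul' f (dual_map Q g) x)"
  by (subst tensor_eq_iff,
      auto simp: \<Delta>_off_dual \<delta>_off_dual tmap_def on_dual2_def \<Delta>_apply \<delta>_apply dual_map_closed)

lemma \<delta>_P_iff: "\<delta> (P x) = tmap s P id (\<delta> x) - tmap s id Q (\<delta> x) \<longleftrightarrow>
    (\<forall>f\<in>dual s. \<forall>g\<in>dual s. br' f g (P x) = br' (dual_map P f) g x - br' f (dual_map Q g) x)"
  by (subst tensor_eq_iff,
      auto simp: \<Delta>_off_dual \<delta>_off_dual tmap_def on_dual2_def \<Delta>_apply \<delta>_apply dual_map_closed)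

lemma \<Delta>_\<Delta>_PQ_iff: "tens_id s \<Delta> (\<Delta> (P x + Q x)) = 0 \<longleftrightarrow>
    (\<forall>f\<in>dual s. \<forall>g\<in>dual s. \<forall>h\<in>dual s. mul' (mul' f g) h (P x + Q x) = 0)"
  by (auto simp: fun_eq_iff tens_id_\<Delta>_apply)

lemma \<Delta>_mul_iff: "\<Delta> (mul x y) = tmap s (mul x) id (\<Delta> y) + tmap s id (mul y) (\<Delta> x) \<longleftrightarrow>
    (\<forall>f\<in>dual s. \<forall>g\<in>dual s. mul' f g (mul x y) =
        mul' (dual_map (mul x) f) g y + mul' f (dual_map (mul y) g) x)"
  by (subst tensor_eq_iff,
      auto simp: \<Delta>_off_dual \<delta>_off_dual tmap_def on_dual2_def \<Delta>_apply \<delta>_apply dual_map_closed)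

lemma \<delta>_br_iff: "\<delta> (br x y) = (tmap s (br x) id (\<delta> y) + tmap s id (br x) (\<delta> y))
          - (tmap s (br y) id (\<delta> x) + tmap s id (br y) (\<delta> x)) \<longleftrightarrow>
    (\<forall>f\<in>dual s. \<forall>g\<in>dual s. br' f g (br x y) =
        (br' (dual_map (br x) f) g y + br' f (dual_map (br x) g) y)
        - (br' (dual_map (br y) f) g x + br' f (dual_map (br y) g) x))"
  by (subst tensor_eq_iff,
      auto simp: \<Delta>_off_dual \<delta>_off_dual tmap_def on_dual2_def \<Delta>_apply \<delta>_apply dual_map_closed)

lemma \<delta>_mul_iff: "\<delta> (mul x y) - tmap s id (br y) (\<Delta> x) - tmap s (mul x) id (\<delta> y)
          - tmap s id (br x) (\<Delta> y) - tmap s (mul y) id (\<delta> x) - tmap s id Q (\<Delta> (mul x y)) = 0 \<longleftrightarrow>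
    (\<forall>f\<in>dual s. \<forall>g\<in>dual s. br' f g (mul x y) - mul' f (dual_map (br y) g) x
        - br' (dual_map (mul x) f) g y - mul' f (dual_map (br x) g) y
        - br' (dual_map (mul y) f) g x - mul' f (dual_map Q g) (mul x y) = 0)"
  by (subst tensor_eq_iff,
      auto simp: \<Delta>_off_dual \<delta>_off_dual tmap_def on_dual2_def \<Delta>_apply \<delta>_apply dual_map_closed)

lemma \<Delta>_br_iff: "\<Delta> (br x y) - tmap s (mul y) id (\<delta> x) - tmap s id (br x) (\<Delta> y)
          + tmap s id (mul y) (\<delta> x) - tmap s (br x) id (\<Delta> y) + \<Delta> (mul (P x) y) = 0 \<longleftrightarrow>
    (\<forall>f\<in>dual s. \<forall>g\<in>dual s. mul' f g (br x y) - br' (dual_map (mul y) f) g x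
        - mul' f (dual_map (br x) g) y + br' f (dual_map (mul y) g) x
        - mul' (dual_map (br x) f) g y + mul' f g (mul (P x) y) = 0)"
  by (subst tensor_eq_iff,
      auto simp: \<Delta>_off_dual \<delta>_off_dual tmap_def on_dual2_def \<Delta>_apply \<delta>_apply dual_map_closed)

section \<open>The matched-pair conditions as scalar identities\<close>

lemma vector_eq_iff: "x = y \<longleftrightarrow> (\<forall>f\<in>dual s. f x = f y)"
  using dual_separates by blast

text \<open>
  A predual inside a product or bracket is freed by transposing the operation onto the linear form.
  As rewrite rules these reduce every term to one product or bracket of two linear forms evaluated
  at a vector.
\<close>

lemma pairing_mul_predual:
  assumes "f \<in> dual s" "g \<in> dual s"
  shows "g (mul x (predual_act s mul' f y)) = - mul' f (dual_map (mul x) g) y"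
    "g (mul x (predual_act s br' f y)) = - br' f (dual_map (mul x) g) y"
    "g (br x (predual_act s mul' f y)) = - mul' f (dual_map (br x) g) y"
    "g (br x (predual_act s br' f y)) = - br' f (dual_map (br x) g) y"
    "g (mul (predual_act s mul' f y) x) = - mul' f (dual_map (mul x) g) y"
    "g (mul (predual_act s br' f y) x) = - br' f (dual_map (mul x) g) y"
    "g (br (predual_act s mul' f y) x) = mul' f (dual_map (br x) g) y"
    "g (br (predual_act s br' f y) x) = br' f (dual_map (br x) g) y"
  using assms pairing_predual_mul'[of f "dual_map (mul x) g" y]
    pairing_predual_br'[of f "dual_map (mul x) g" y]
    pairing_predual_mul'[of f "dual_map (br x) g" y]
    pairing_predual_br'[of f "dual_map (br x) g" y]
    A.mul_commute[of _ x] A.br_anti[of _ x]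
  by (simp_all add: dual_map_closed dual_minus)

lemmas pairing_simps = pairing_predual_mul' pairing_predual_br' pairing_mul_predual dual_act_eq
  dual_add dual_diff dual_minus dual_zero dual_closed dual_map_closed D.mul.closed D.br.closed
  D.mul.distribs D.br.distribs A.mul.distribs A.br.distribs

text \<open>
  Each pair of matched-pair axioms treated next has the same scalar identity: an equation between linear
  forms is tested on a vector \<open>y\<close>, and one between vectors on a linear form. In the Leibniz cases this
  links \<open>mp_\<rho>2_mul\<close> with \<open>mp_\<mu>1_br\<close> and \<open>mp_\<rho>1_mul\<close> with \<open>mp_\<mu>2_br\<close>, since the pairing moves an argument
  from one factor of the product to the test position.
\<close>

lemma mp_\<mu>1_mul_iff: "coad_mul x (mul' f g) =
     mul' (coad_mul x f) g + coad_mul (coad_mul' f x) g \<longleftrightarrow>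
   (\<forall>y. mul' f g (mul x y) = mul' (dual_map (mul x) f) g y + mul' f (dual_map (mul y) g) x)"
  if "f \<in> dual s" "g \<in> dual s"
  using that by (simp add: pairing_simps fun_eq_iff)

lemma mp_\<mu>2_mul_iff: "coad_mul' f (mul x y) = mul (coad_mul' f x) y + coad_mul' (coad_mul x f) y \<longleftrightarrow>
   (\<forall>g\<in>dual s. mul' f g (mul x y) = mul' (dual_map (mul x) f) g y + mul' f (dual_map (mul y) g) x)"
  if "f \<in> dual s"
  using that by (subst vector_eq_iff) (auto simp add: pairing_simps algebra_simps)

lemma mp_\<rho>1_br_iff: "coad_br x (br' f g) - br' (coad_br x f) g - br' f (coad_br x g)
          + coad_br (coad_br' f x) g - coad_br (coad_br' g x) f = 0 \<longleftrightarrow>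
   (\<forall>y. br' f g (br x y) =
        (br' (dual_map (br x) f) g y + br' f (dual_map (br x) g) y)
        - (br' (dual_map (br y) f) g x + br' f (dual_map (br y) g) x))"
  if "f \<in> dual s" "g \<in> dual s"
  using that D.br_anti[of g "dual_map (br _) f"]
  by (auto simp add: pairing_simps fun_eq_iff algebra_simps)

lemma mp_\<rho>2_br_iff: "coad_br' f (br x y) - br (coad_br' f x) y - br x (coad_br' f y)
          + coad_br' (coad_br x f) y - coad_br' (coad_br y f) x = 0 \<longleftrightarrow>
   (\<forall>g\<in>dual s. br' f g (br x y) =
        (br' (dual_map (br x) f) g y + br' f (dual_map (br x) g) y)
        - (br' (dual_map (br y) f) g x + br' f (dual_map (br y) g) x))"
  if "f \<in> dual s"
  using that by (subst vector_eq_iff) (auto simp add: pairing_simps algebra_simps)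

lemma mp_\<rho>2_mul_iff: "coad_br' g (mul x y) + coad_mul' (coad_br y g) x - mul x (coad_br' g y)
          + coad_mul' (coad_br x g) y - mul y (coad_br' g x) - coad_mul' (dual_map Q g) (mul x y) = 0 \<longleftrightarrow>
   (\<forall>f\<in>dual s. br' f g (mul x y) - mul' f (dual_map (br y) g) x
        - br' (dual_map (mul x) f) g y - mul' f (dual_map (br x) g) y
        - br' (dual_map (mul y) f) g x - mul' f (dual_map Q g) (mul x y) = 0)"
  if "g \<in> dual s"
  using that by (subst vector_eq_iff)
    (auto simp add: pairing_simps algebra_simps D.br_anti[of g]
      D.mul_commute[of "dual_map (br _) g"] D.mul_commute[of "dual_map Q g"])

lemma mp_\<mu>1_br_iff: "coad_br (coad_mul' f x) g + br' (coad_mul x f) g - mul' f (coad_br x g)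
          + coad_mul (coad_br' g x) f - coad_mul x (br' f g)
          + coad_mul x (mul' f (dual_map Q g)) = 0 \<longleftrightarrow>
   (\<forall>y. br' f g (mul x y) - mul' f (dual_map (br y) g) x
        - br' (dual_map (mul x) f) g y - mul' f (dual_map (br x) g) y
        - br' (dual_map (mul y) f) g x - mul' f (dual_map Q g) (mul x y) = 0)"
  if "f \<in> dual s" "g \<in> dual s"
  using that
  by (auto simp add: pairing_simps fun_eq_iff algebra_simps D.br_anti[of g])

lemma mp_\<rho>1_mul_iff: "coad_br x (mul' f g) + coad_mul (coad_br' g x) f - mul' f (coad_br x g)
          + coad_mul (coad_br' f x) g - mul' g (coad_br x f)
          - coad_mul (P x) (mul' f g) = 0 \<longleftrightarrow>
   (\<forall>y. mul' f g (br x y) - br' (dual_map (mul y) f) g x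
        - mul' f (dual_map (br x) g) y + br' f (dual_map (mul y) g) x
        - mul' (dual_map (br x) f) g y + mul' f g (mul (P x) y) = 0)"
  if "f \<in> dual s" "g \<in> dual s"
  using that
  by (auto simp add: pairing_simps fun_eq_iff algebra_simps D.br_anti[of g] D.mul_commute[of g])

lemma mp_\<mu>2_br_iff: "coad_br' (coad_mul x f) y + br (coad_mul' f x) y - mul x (coad_br' f y)
          + coad_mul' (coad_br y f) x - coad_mul' f (br x y) + coad_mul' f (mul x (P y)) = 0 \<longleftrightarrow>
   (\<forall>g\<in>dual s. mul' f g (br y x) - br' (dual_map (mul x) f) g y
        - mul' f (dual_map (br y) g) x + br' f (dual_map (mul x) g) y
        - mul' (dual_map (br y) f) g x + mul' f g (mul (P y) x) = 0)"
  if "f \<in> dual s"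
  using that by (subst vector_eq_iff)
    (auto simp add: pairing_simps algebra_simps A.br_anti[of y x] A.mul_commute[of "P y" x])

section \<open>The dual algebra acting on \<open>A\<close>\<close>

text \<open>
  In the sum of the three Leibniz rules for \<open>[h, f g]\<close>, \<open>[g, f h]\<close> and \<open>[f, g h]\<close> all brackets cancel, and
  what remains is the derivation applied to \<open>f g h\<close>. This is why \<open>P\<close> and \<open>Q\<close> occur only as \<open>P + Q\<close>
  in the condition on the iterated coproduct.
\<close>

lemma br'_mul'_cyclic:
  assumes "f \<in> dual s" "g \<in> dual s" "h \<in> dual s"
  shows "br' (mul' f g) h v = br' g (mul' f h) v + br' f (mul' g h) v - mul' (mul' f g) h (Q v)"
proof -
  note [simp] = assms D.mul.closed D.br.closed dual_map_closed dual_closed D.mul.distribs D.br.distribs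
  have "br' (mul' f g) h = - br' h (mul' f g)" by (simp add: D.br_anti[of _ h])
  moreover have "br' h (mul' f g) = mul' (br' h f) g + mul' f (br' h g) + mul' (mul' f g) (dual_map Q h)"
    "br' g (mul' f h) = mul' (br' g f) h + mul' f (br' g h) + mul' (mul' f h) (dual_map Q g)"
    "br' f (mul' g h) = mul' (br' f g) h + mul' g (br' f h) + mul' (mul' g h) (dual_map Q f)"
    by (simp_all add: D.rel_leibniz)
  moreover have "br' h f = - br' f h" "br' h g = - br' g h" "br' g f = - br' f g"
    by (simp_all add: D.br_anti[of h] D.br_anti[of g f])
  moreover have "mul' (br' f h) g = mul' g (br' f h)" by (rule D.mul_commute) simp_all
  moreover have "dual_map Q (mul' (mul' f g) h) =
      mul' (mul' g h) (dual_map Q f) + mul' (mul' f h) (dual_map Q g) + mul' (mul' f g) (dual_map Q h)"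
    by (simp add: D.P_mul D.mul_assoc D.mul_commute[of "dual_map Q _"] D.mul_commute[of g h])
  then have "mul' (mul' f g) h (Q v) =
      mul' (mul' g h) (dual_map Q f) v + mul' (mul' f h) (dual_map Q g) v + mul' (mul' f g) (dual_map Q h) v"
    by (simp add: fun_eq_iff)
  ultimately show ?thesis by simp
qed

lemma pairing_P_predual:
  assumes "f \<in> dual s" "g \<in> dual s"
  shows "g (P (predual_act s mul' f v)) = - mul' f (dual_map P g) v"
    "g (P (predual_act s br' f v)) = - br' f (dual_map P g) v"
  using assms pairing_predual_mul'[of f "dual_map P g" v] pairing_predual_br'[of f "dual_map P g" v]
  by (simp_all add: dual_map_closed)

lemma \<alpha>_\<mu>_iff:
  assumes "f \<in> dual s"
  shows "P (coad_mul' f v) - coad_mul' (dual_map Q f) v - coad_mul' f (P v) = 0 \<longleftrightarrow>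
    (\<forall>g\<in>dual s. mul' g f (P v) = mul' (dual_map P g) f v - mul' g (dual_map Q f) v)"
    (is "?X = 0 \<longleftrightarrow> _")
proof -
  have eq: "g ?X = mul' (dual_map P g) f v - mul' g (dual_map Q f) v - mul' g f (P v)"
    if "g \<in> dual s" for g
    using that assms D.mul_commute[of f g] D.mul_commute[of "dual_map P g" f]
      D.mul_commute[of "dual_map Q f" g]
    by (simp add: pairing_simps pairing_P_predual A.P_minus)
  have "g ?X = g 0 \<longleftrightarrow> mul' g f (P v) = mul' (dual_map P g) f v - mul' g (dual_map Q f) v"
    if "g \<in> dual s" for g
    unfolding eq[OF that] dual_zero[OF that] by auto
  then show ?thesis
    using vector_eq_iff[of ?X 0] by blast
qed

lemma \<alpha>_\<rho>_iff:
  assumes "f \<in> dual s"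
  shows "P (coad_br' f v) - coad_br' (dual_map Q f) v - coad_br' f (P v) = 0 \<longleftrightarrow>
    (\<forall>g\<in>dual s. br' g f (P v) = br' (dual_map P g) f v - br' g (dual_map Q f) v)"
    (is "?X = 0 \<longleftrightarrow> _")
proof -
  have eq: "g ?X = br' (dual_map P g) f v - br' g (dual_map Q f) v - br' g f (P v)"
    if "g \<in> dual s" for g
    using that assms D.br_anti[of f g] D.br_anti[of "dual_map P g" f]
      D.br_anti[of "dual_map Q f" g]
    by (simp add: pairing_simps pairing_P_predual)
  have "g ?X = g 0 \<longleftrightarrow> br' g f (P v) = br' (dual_map P g) f v - br' g (dual_map Q f) v"
    if "g \<in> dual s" for g
    unfolding eq[OF that] dual_zero[OF that] by auto
  then show ?thesis
    using vector_eq_iff[of ?X 0] by blast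
qed

lemma \<rho>_mul_iff: "coad_br' (mul' f g) v - coad_mul' f (coad_br' g v) - coad_mul' g (coad_br' f v)
          + coad_mul' (mul' f g) (P v) = 0 \<longleftrightarrow>
    (\<forall>h\<in>dual s. mul' (mul' f g) h (P v + Q v) = 0)"
  if "f \<in> dual s" "g \<in> dual s"
  using that by (subst vector_eq_iff)
    (auto simp: pairing_simps br'_mul'_cyclic algebra_simps)

text \<open>
  The three conditions match the axioms of a representation that involve \<open>P\<close>. The transposes
  of associativity, the Jacobi identity and the Leibniz rule of the dual algebra give the others.
\<close>

lemma dual_representation_iff:
  "rel_poisson_representation dscale (dual s) mul' br' (dual_map Q) s UNIV coad_mul' coad_br' P \<longleftrightarrow>
    (\<forall>x. \<Delta> (P x) = tmap s P id (\<Delta> x) - tmap s id Q (\<Delta> x)) \<and>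
    (\<forall>x. \<delta> (P x) = tmap s P id (\<delta> x) - tmap s id Q (\<delta> x)) \<and>
    (\<forall>x. tens_id s \<Delta> (\<Delta> (P x + Q x)) = 0)"
    (is "?rep \<longleftrightarrow> ?R")
proof
  assume ?rep
  then interpret R: rel_poisson_representation dscale "dual s" mul' br' "dual_map Q" s UNIV coad_mul' coad_br' P .
  show ?R
    unfolding \<Delta>_P_iff \<delta>_P_iff \<Delta>_\<Delta>_PQ_iff
    using \<alpha>_\<mu>_iff[THEN iffD1, OF _ R.\<alpha>_\<mu>] \<alpha>_\<rho>_iff[THEN iffD1, OF _ R.\<alpha>_\<rho>]
      \<rho>_mul_iff[THEN iffD1, OF _ _ R.\<rho>_mul] by blast
next
  assume ?R
  then have R: "f \<in> dual s \<Longrightarrow> P (coad_mul' f v) - coad_mul' (dual_map Q f) v - coad_mul' f (P v) = 0"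
    "f \<in> dual s \<Longrightarrow> P (coad_br' f v) - coad_br' (dual_map Q f) v - coad_br' f (P v) = 0"
    "f \<in> dual s \<Longrightarrow> g \<in> dual s \<Longrightarrow>
      coad_br' (mul' f g) v - coad_mul' f (coad_br' g v) - coad_mul' g (coad_br' f v)
        + coad_mul' (mul' f g) (P v) = 0" for f g v
    unfolding \<Delta>_P_iff \<delta>_P_iff \<Delta>_\<Delta>_PQ_iff
    by (simp_all only: \<alpha>_\<mu>_iff \<alpha>_\<rho>_iff \<rho>_mul_iff) blast+
  show ?rep
  proof unfold_locales
    fix f g :: "'a \<Rightarrow> 'k" and v
    assume [simp]: "f \<in> dual s" "g \<in> dual s"
    show "coad_mul' (mul' f g) v = coad_mul' f (coad_mul' g v)"
    proof (rule dual_separates)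
      fix h assume [simp]: "h \<in> dual s"
      have "mul' (mul' f g) h = mul' g (mul' f h)"
        using D.mul_commute[of f g] D.mul_assoc[of g f h] by simp
      then show "h (coad_mul' (mul' f g) v) = h (coad_mul' f (coad_mul' g v))"
        by (simp add: pairing_simps)
    qed
    show "coad_br' (br' f g) v = coad_br' f (coad_br' g v) - coad_br' g (coad_br' f v)"
    proof (rule dual_separates)
      fix h assume [simp]: "h \<in> dual s"
      have "br' (br' f g) h = - br' h (br' f g)" "br' h f = - br' f h"
        by (rule D.br_anti; simp add: D.br.closed)+
      moreover have "br' g (br' h f) = - br' g (br' f h)"
        by (simp only: \<open>br' h f = _\<close>) (simp add: D.br.minus_right D.br.closed)
      ultimately have "br' (br' f g) h v = br' f (br' g h) v - br' g (br' f h) v"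
        using fun_cong[OF D.jacobi[of f g h], of v] by (simp add: algebra_simps)
      then show "h (coad_br' (br' f g) v) = h (coad_br' f (coad_br' g v) - coad_br' g (coad_br' f v))"
        by (simp add: pairing_simps)
    qed
    show "coad_br' g (coad_mul' f v) - coad_mul' f (coad_br' g v) + coad_mul' (br' f g) v
        - coad_mul' (mul' f (dual_map Q g)) v = 0"
    proof (rule dual_separates)
      fix h assume [simp]: "h \<in> dual s"
      have "mul' (mul' f h) (dual_map Q g) = mul' (mul' f (dual_map Q g)) h"
        using D.mul_commute[of h "dual_map Q g"] by (simp add: D.mul_assoc dual_map_closed)
      moreover have "br' g f = - br' f g" by (simp add: D.br_anti[of g])
      ultimately show "h (coad_br' g (coad_mul' f v) - coad_mul' f (coad_br' g v) + coad_mul' (br' f g) v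
        - coad_mul' (mul' f (dual_map Q g)) v) = h 0"
        using D.rel_leibniz[of f h g]
        by (simp add: pairing_simps)
    qed
    show "coad_br' (mul' f g) v - coad_mul' f (coad_br' g v) - coad_mul' g (coad_br' f v)
        + coad_mul' (mul' f g) (P v) = 0"
      by (rule R) simp_all
  next
    fix f :: "'a \<Rightarrow> 'k" and v
    assume [simp]: "f \<in> dual s"
    show "P (coad_mul' f v) - coad_mul' (dual_map Q f) v - coad_mul' f (P v) = 0"
      "P (coad_br' f v) - coad_br' (dual_map Q f) v - coad_br' f (P v) = 0"
      by (rule R; simp)+
  qed (rule A.subspace_carrier predual_bilinear A.P_linear)+
qed

section \<open>The equivalences\<close>

theorem matched_pair_iff_bialgebra:
  "rel_poisson_matched_pair s UNIV mul br P dscale (dual s) mul' br' (dual_map Q)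
     coad_mul coad_br coad_mul' coad_br' \<longleftrightarrow>
   rel_poisson_bialgebra s mul br \<Delta> \<delta> P Q"
proof
  assume "rel_poisson_matched_pair s UNIV mul br P dscale (dual s) mul' br' (dual_map Q)
     coad_mul coad_br coad_mul' coad_br'"
  then interpret M: rel_poisson_matched_pair s UNIV mul br P dscale "dual s" mul' br' "dual_map Q"
    coad_mul coad_br coad_mul' coad_br' .
  show "rel_poisson_bialgebra s mul br \<Delta> \<delta> P Q"
  proof (intro rel_poisson_bialgebra.intro rel_poisson_bialgebra_axioms.intro
      A.rel_poisson_algebra_axioms C.rel_poisson_coalgebra_axioms)
    show "dually_represents s mul br P Q"
      unfolding dually_represents_def
      using C.Q_linear M.A1.rel_poisson_representation_axioms by blast
    fix x y
    have R: "rel_poisson_representation dscale (dual s) mul' br' (dual_map Q) s UNIV coad_mul' coad_br' P"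
      by (rule M.A2.rel_poisson_representation_axioms)
    show "\<Delta> (P x) = tmap s P id (\<Delta> x) - tmap s id Q (\<Delta> x)"
      "\<delta> (P x) = tmap s P id (\<delta> x) - tmap s id Q (\<delta> x)"
      "tens_id s \<Delta> (\<Delta> (P x + Q x)) = 0"
      using R[unfolded dual_representation_iff] by blast+
    show "\<Delta> (mul x y) = tmap s (mul x) id (\<Delta> y) + tmap s id (mul y) (\<Delta> x)"
      unfolding \<Delta>_mul_iff using mp_\<mu>1_mul_iff[THEN iffD1, OF _ _ M.mp_\<mu>1_mul[OF UNIV_I]] by blast
    show "\<delta> (br x y) = (tmap s (br x) id (\<delta> y) + tmap s id (br x) (\<delta> y))
          - (tmap s (br y) id (\<delta> x) + tmap s id (br y) (\<delta> x))"
      unfolding \<delta>_br_iff using mp_\<rho>1_br_iff[THEN iffD1, OF _ _ M.mp_\<rho>1_br[OF UNIV_I]] by blast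
    show "\<delta> (mul x y) - tmap s id (br y) (\<Delta> x) - tmap s (mul x) id (\<delta> y)
          - tmap s id (br x) (\<Delta> y) - tmap s (mul y) id (\<delta> x) - tmap s id Q (\<Delta> (mul x y)) = 0"
      unfolding \<delta>_mul_iff using mp_\<mu>1_br_iff[THEN iffD1, OF _ _ M.mp_\<mu>1_br[OF UNIV_I]] by blast
    show "\<Delta> (br x y) - tmap s (mul y) id (\<delta> x) - tmap s id (br x) (\<Delta> y)
          + tmap s id (mul y) (\<delta> x) - tmap s (br x) id (\<Delta> y) + \<Delta> (mul (P x) y) = 0"
      unfolding \<Delta>_br_iff using mp_\<rho>1_mul_iff[THEN iffD1, OF _ _ M.mp_\<rho>1_mul[OF UNIV_I]] by blast
  qed
next
  assume "rel_poisson_bialgebra s mul br \<Delta> \<delta> P Q"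
  then interpret B: rel_poisson_bialgebra s mul br \<Delta> \<delta> P Q .
  note S = B.\<Delta>_mul[unfolded \<Delta>_mul_iff] B.\<delta>_br[unfolded \<delta>_br_iff]
    B.\<delta>_mul[unfolded \<delta>_mul_iff] B.\<Delta>_br[unfolded \<Delta>_br_iff]
  show "rel_poisson_matched_pair s UNIV mul br P dscale (dual s) mul' br' (dual_map Q)
     coad_mul coad_br coad_mul' coad_br'"
  proof (rule rel_poisson_matched_pair.intro)
    show "rel_poisson_representation s UNIV mul br P dscale (dual s)
        coad_mul coad_br (dual_map Q)"
      using B.Q_dually_represents by (simp only: dually_represents_def)
    show "rel_poisson_representation dscale (dual s) mul' br' (dual_map Q) s UNIV coad_mul' coad_br' P"
      using B.\<Delta>_P B.\<delta>_P B.\<Delta>_\<Delta>_PQ by (simp only: dual_representation_iff) blast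
    show "rel_poisson_matched_pair_axioms UNIV mul br P (dual s) mul' br' (dual_map Q)
        coad_mul coad_br coad_mul' coad_br'"
      by unfold_locales
        (simp_all only: mp_\<mu>1_mul_iff mp_\<mu>2_mul_iff mp_\<rho>1_br_iff mp_\<rho>2_br_iff
          mp_\<rho>1_mul_iff mp_\<rho>2_mul_iff mp_\<mu>1_br_iff mp_\<mu>2_br_iff, (use S in blast)+)
  qed
qed

end

theorem corollary3p16:
  fixes s :: "'k::{alg_closed_field, field_char_0} \<Rightarrow> 'a::ab_group_add \<Rightarrow> 'a"
    and Basis :: "'a set"
    and mul br :: "'a \<Rightarrow> 'a \<Rightarrow> 'a"
    and P Q :: "'a \<Rightarrow> 'a"
    and \<Delta> \<delta> :: "'a \<Rightarrow> ('a \<Rightarrow> 'k) \<Rightarrow> ('a \<Rightarrow> 'k) \<Rightarrow> 'k"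
    and mul' br' :: "('a \<Rightarrow> 'k) \<Rightarrow> ('a \<Rightarrow> 'k) \<Rightarrow> 'a \<Rightarrow> 'k"
  assumes "finite_dimensional_vector_space s Basis"
    and "rel_poisson_algebra s UNIV mul br P"
    and "rel_poisson_coalgebra s \<Delta> \<delta> Q"
    and "\<And>f g. f \<in> dual s \<Longrightarrow> g \<in> dual s \<Longrightarrow> mul' f g = dual_map \<Delta> (dual_tensor f g)"
    and "\<And>f g. f \<in> dual s \<Longrightarrow> g \<in> dual s \<Longrightarrow> br' f g = dual_map \<delta> (dual_tensor f g)"
    and "rel_poisson_algebra dscale (dual s) mul' br' (dual_map Q)"
  shows "((\<exists>M N. rel_poisson_manin_triple s mul br P mul' br' Q M N) \<longleftrightarrow>
          rel_poisson_matched_pair s UNIV mul br P dscale (dual s) mul' br' (dual_map Q)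
            (- dual_act mul) (dual_act br) (- predual_act s mul') (predual_act s br'))
       \<and> (rel_poisson_matched_pair s UNIV mul br P dscale (dual s) mul' br' (dual_map Q)
            (- dual_act mul) (dual_act br) (- predual_act s mul') (predual_act s br') \<longleftrightarrow>
          rel_poisson_bialgebra s mul br \<Delta> \<delta> P Q)"
proof -
  interpret rel_poisson_dual_pair s Basis mul br P Q \<Delta> \<delta> mul' br'
    by (intro rel_poisson_dual_pair.intro rel_poisson_dual_pair_axioms.intro assms)
  show ?thesis
    using manin_triple_iff_double pair.matched_pair_iff_bowtie matched_pair_iff_bialgebra by blast
qed

end
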